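(* Let $c>1$, $q=0$, $0<p<r$, $p+r=1$ and $k\in\mathbb{Z}$. Then $\rho^{(k)}$ and $\mu^{(k)}$ both have bounded support contained in $[0,\infty)$, but the quasi-Lévy measures $\nu_{\rho^{(k)}}$ and $\nu_{\mu^{(k)}}$ in their Lévy–Khintchine-like representations $$\widehat\rho^{(k)}(z)=\exp\left[\int_{\mathbb{R}}(e^{izx}-1)\,\nu_{\rho^{(k)}}(dx)+ic^{-k}z\right],\qquad \widehat\mu^{(k)}(z)=\exp\left[\int_{\mathbb{R}}(e^{izx}-1)\,\nu_{\mu^{(k)}}(dx)+i\sum_{n=0}^\infty c^{-k-n}z\right],\quad z\in\mathbb{R},$$ respectively, are concentrated on $(-\infty,0)$.
   Context: Setup. For $k\in\mathbb{Z}$, $c>1$ and $p,q,r\ge0$ with $p+q+r=1$, $p+r>0$, $q+r>0$, let $\{(N_t^{(k)},L_t^{(k)}),t\ge0\}$ be the bivariate compound Poisson process (pure jump, no drift) with $E[e^{i(z_1N_t^{(k)}+z_2L_t^{(k)})}]=\exp[t\int_{\mathbb{R}^2}(e^{i(z_1x_1+z_2x_2)}-1)\nu^{(k)}(dx)]$, where $\nu^{(k)}$ is concentrated on the points $(1,0)$, $(0,1)$, $(1,c^{-k})$ with masses $u,v,w\ge0$ respectively, and $p=u/(u+v+w)$, $q=v/(u+v+w)$, $r=w/(u+v+w)$. Let $T$ be the first jump time of $\{N_t^{(k)}\}$. Define $\rho^{(k)}$ as the distribution of $L_T^{(k)}$, and $\mu^{(k)}$ as the distribution of $\int_0^{\infty-}c^{-N^{(k)}_{s-}}\,dL_s^{(k)}$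 (the almost sure limit of $\int_0^t$ as $t\to\infty$, which exists). These depend on $u,v,w$ only through $p,q,r$. $\widehat\sigma$ denotes the characteristic function of $\sigma$. Quasi-infinite divisibility. A distribution $\sigma$ on $\mathbb{R}$ is quasi-infinitely divisible if $\widehat\sigma(z)=\exp[i\gamma z-az^2+\int_{\mathbb{R}}(e^{izx}-1-izx1_{[-1,1]}(x))\,\nu_\sigma(dx)]$, where $\gamma,a\in\mathbb{R}$ and $\nu_\sigma$ is a signed measure (a difference $\nu_\sigma^+-\nu_\sigma^-$ of mutually singular measures, possibly both of infinite mass near $0$) with total variation measure $|\nu_\sigma|$ satisfying $\nu_\sigma(\{0\})=0$ and $\int(x^2\wedge1)\,|\nu_\sigma|(dx)<\infty$. Then $\gamma,a,\nu_\sigma$ are unique, and $\nu_\sigma$ is called the quasi-Lévy measure of $\sigma$. *)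

theory Defs
  imports "HOL-Probability.Probability"
begin

section \<open>Levy processes\<close>

locale levy_process = prob_space M
  for M :: "'a measure"
    and X :: "real \<Rightarrow> 'a \<Rightarrow> 'b::{second_countable_topology, real_normed_vector}" +
  assumes random_variable: "t \<ge> 0 \<Longrightarrow> X t \<in> borel_measurable M"
    and start_zero: "AE \<omega> in M. X 0 \<omega> = 0"
    and independent_increments:
      "0 \<le> s 0 \<Longrightarrow> (\<And>i. i < n \<Longrightarrow> s i < s (Suc i)) \<Longrightarrow>
        indep_vars (\<lambda>_. borel)
          (\<lambda>i \<omega>. if i = 0 then X (s 0) \<omega> else X (s i) \<omega> - X (s (i - 1)) \<omega>) {..n::nat}"
    and stationary_increments:
      "0 \<le> a \<Longrightarrow> 0 \<le> t \<Longrightarrow>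
        distr M borel (\<lambda>\<omega>. X (a + t) \<omega> - X a \<omega>) = distr M borel (X t)"
    and stochastic_continuity:
      "0 \<le> t \<Longrightarrow> 0 < \<epsilon> \<Longrightarrow>
        ((\<lambda>a. prob {\<omega> \<in> space M. norm (X a \<omega> - X t \<omega>) > \<epsilon>}) \<longlongrightarrow> 0) (at t within {0..})"
    and cadlag_paths:
      "AE \<omega> in M.
        (\<forall>t\<ge>0. continuous (at_right t) (\<lambda>a. X a \<omega>)) \<and>
        (\<forall>t>0. \<exists>l. ((\<lambda>a. X a \<omega>) \<longlongrightarrow> l) (at_left t))"

section \<open>The bivariate compound Poisson process\<close>

definition jump_measure ::
    "real \<Rightarrow> int \<Rightarrow> real \<Rightarrow> real \<Rightarrow> real \<Rightarrow> (real \<times> real) measure" where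
  "jump_measure c k u v w =
     distr (point_measure {(1, 0), (0, 1), (1, c powi (-k))}
              (\<lambda>x. ennreal (if x = (1, 0) then u else if x = (0, 1) then v else w)))
       borel (\<lambda>x. x)"

lemma emeasure_jump_measure:
  assumes "c > 1" and "A \<in> sets borel"
  shows "emeasure (jump_measure c k u v w) A =
    ennreal u * indicator A (1, 0) + ennreal v * indicator A (0, 1) +
    ennreal w * indicator A (1, c powi (-k))"
proof -
  define S where "S = {(1, 0), (0, 1), (1, c powi (-k)) :: real \<times> real}"
  define m where "m = (\<lambda>x::real \<times> real. ennreal (if x = (1, 0) then u else if x = (0, 1) then v else w))"
  have ne: "c powi (-k) \<noteq> 0"
    using assms(1) by simp
  have fin: "finite S"
    unfolding S_def by simp
  have "(\<lambda>x. x) \<in> point_measure S m \<rightarrow>\<^sub>M borel"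
    by (rule measurableI) (auto simp: space_point_measure sets_point_measure)
  then have "emeasure (jump_measure c k u v w) A = emeasure (point_measure S m) (A \<inter> S)"
    unfolding jump_measure_def S_def[symmetric] m_def[symmetric]
    using assms(2) by (simp add: emeasure_distr space_point_measure vimage_def Int_def)
  also have "\<dots> = (\<Sum>x\<in>A \<inter> S. m x)"
    by (rule emeasure_point_measure_finite[OF fin]) simp
  also have "\<dots> = (\<Sum>x\<in>S. m x * indicator A x)"
    by (intro sum.mono_neutral_cong_left fin) (auto simp: indicator_def)
  also have "\<dots> = m (1, 0) * indicator A (1, 0) + (m (0, 1) * indicator A (0, 1) +
      m (1, c powi (-k)) * indicator A (1, c powi (-k)))"
    unfolding S_def using ne by (subst sum.insert, simp, simp)+ simp
  also have "\<dots> = ennreal u * indicator A (1, 0) + ennreal v * indicator A (0, 1) +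
      ennreal w * indicator A (1, c powi (-k))"
    unfolding m_def using ne by (simp only: prod.inject add.assoc) simp
  finally show ?thesis .
qed

locale NL_process =
  levy_process M "\<lambda>t \<omega>. (N t \<omega>, L t \<omega>)"
  for M :: "'a measure" and N L :: "real \<Rightarrow> 'a \<Rightarrow> real" +
  fixes c :: real and k :: int and u v w :: real
  assumes c_gt_1: "c > 1"
    and masses_nonneg: "u \<ge> 0" "v \<ge> 0" "w \<ge> 0"
    and masses_pos: "u + w > 0" "v + w > 0"
    and characteristic_function:
      "t \<ge> 0 \<Longrightarrow>
        (CLINT \<omega>|M. iexp (z1 * N t \<omega> + z2 * L t \<omega>)) =
        exp (complex_of_real t *
          (CLINT x|jump_measure c k u v w. iexp (z1 * fst x + z2 * snd x) - 1))"

definition left_limit :: "(real \<Rightarrow> real) \<Rightarrow> real \<Rightarrow> real" where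
  "left_limit f t = Lim (at_left t) f"

definition first_jump_time :: "(real \<Rightarrow> real) \<Rightarrow> real" where
  "first_jump_time f = Inf {t. t > 0 \<and> left_limit f t \<noteq> f t}"

text \<open>Almost every path of \<open>L\<close> is nondecreasing and right-continuous, so the pathwise integral over
  \<open>(0, t]\<close> is a Lebesgue-Stieltjes integral. The path is extended by \<open>L 0\<close> to negative times.\<close>

definition exp_integral_upto ::
    "real \<Rightarrow> (real \<Rightarrow> real) \<Rightarrow> (real \<Rightarrow> real) \<Rightarrow> real \<Rightarrow> real" where
  "exp_integral_upto c N L t =
     (LINT s:{0<..t}|interval_measure (\<lambda>s. L (max 0 s)). c powr (- left_limit N s))"

definition exp_integral :: "real \<Rightarrow> (real \<Rightarrow> real) \<Rightarrow> (real \<Rightarrow> real) \<Rightarrow> real" where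
  "exp_integral c N L = Lim at_top (exp_integral_upto c N L)"

text \<open>The path functionals above are meaningful only outside a null set, on which they need not be
  measurable; hence laws are taken with respect to the completion of the probability space.\<close>

definition law :: "'a measure \<Rightarrow> ('a \<Rightarrow> real) \<Rightarrow> real measure" where
  "law M Y = distr (completion M) borel Y"

definition rho :: "'a measure \<Rightarrow> (real \<Rightarrow> 'a \<Rightarrow> real) \<Rightarrow> (real \<Rightarrow> 'a \<Rightarrow> real) \<Rightarrow> real measure" where
  "rho M N L = law M (\<lambda>\<omega>. L (first_jump_time (\<lambda>t. N t \<omega>)) \<omega>)"

definition mu ::
    "'a measure \<Rightarrow> real \<Rightarrow> (real \<Rightarrow> 'a \<Rightarrow> real) \<Rightarrow> (real \<Rightarrow> 'a \<Rightarrow> real) \<Rightarrow> real measure" where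
  "mu M c N L = law M (\<lambda>\<omega>. exp_integral c (\<lambda>t. N t \<omega>) (\<lambda>t. L t \<omega>))"

section \<open>Supports and quasi-Levy measures\<close>

definition measure_support :: "real measure \<Rightarrow> real set" where
  "measure_support \<sigma> = {x. \<forall>U. open U \<longrightarrow> x \<in> U \<longrightarrow> emeasure \<sigma> U > 0}"

text \<open>A signed measure \<open>\<nu>\<^sup>+ - \<nu>\<^sup>-\<close>, both parts of which may be infinite near \<open>0\<close>, is represented by the
  pair of its mutually singular parts.\<close>

definition mutually_singular :: "real measure \<Rightarrow> real measure \<Rightarrow> bool" where
  "mutually_singular \<nu>p \<nu>m \<longleftrightarrow>
     (\<exists>A\<in>sets borel. emeasure \<nu>p A = 0 \<and> emeasure \<nu>m (- A) = 0)"

definition signed_integrable ::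
    "real measure \<Rightarrow> real measure \<Rightarrow> (real \<Rightarrow> complex) \<Rightarrow> bool" where
  "signed_integrable \<nu>p \<nu>m f \<longleftrightarrow> integrable \<nu>p f \<and> integrable \<nu>m f"

definition signed_integral ::
    "real measure \<Rightarrow> real measure \<Rightarrow> (real \<Rightarrow> complex) \<Rightarrow> complex" where
  "signed_integral \<nu>p \<nu>m f = (CLINT x|\<nu>p. f x) - (CLINT x|\<nu>m. f x)"

definition is_quasi_levy_measure ::
    "real measure \<Rightarrow> real measure \<Rightarrow> real measure \<Rightarrow> bool" where
  "is_quasi_levy_measure \<sigma> \<nu>p \<nu>m \<longleftrightarrow>
     sets \<nu>p = sets borel \<and> sets \<nu>m = sets borel \<and>
     mutually_singular \<nu>p \<nu>m \<and>
     emeasure \<nu>p {0} = 0 \<and> emeasure \<nu>m {0} = 0 \<and>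
     (\<integral>\<^sup>+ x. ennreal (min (x\<^sup>2) 1) \<partial>\<nu>p) < \<infinity> \<and>
     (\<integral>\<^sup>+ x. ennreal (min (x\<^sup>2) 1) \<partial>\<nu>m) < \<infinity> \<and>
     (\<exists>\<gamma> a :: real. \<forall>z.
       char \<sigma> z = exp (\<i> * of_real (\<gamma> * z) - of_real (a * z\<^sup>2) +
         signed_integral \<nu>p \<nu>m
           (\<lambda>x. iexp (z * x) - 1 - \<i> * of_real (z * x * indicator {-1..1} x))))"

definition signed_concentrated_on ::
    "real measure \<Rightarrow> real measure \<Rightarrow> real set \<Rightarrow> bool" where
  "signed_concentrated_on \<nu>p \<nu>m B \<longleftrightarrow> emeasure \<nu>p (- B) = 0 \<and> emeasure \<nu>m (- B) = 0"

end

theory Submission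
  imports Defs
begin

text \<open>With \<open>v = 0\<close> and \<open>a = c\<^sup>-\<^sup>k\<close>, both functionals are integrals \<open>\<integral> \<theta>\<^bsup>N(s-)\<^esup> dL(s)\<close>: for \<open>\<theta> = 0\<close>
  (where \<open>0\<^sup>0 = 1\<close>) the integral is \<open>L(T)\<close>, and for \<open>\<theta> = 1/c\<close> it is the exponential integral. Almost surely it is
  the limit of its Riemann sums \<open>Y\<close> along dyadic grids. If \<open>\<Phi>\<close> is continuous with \<open>\<Phi>(0) = 1\<close> and
  \<open>\<Phi>(z) = (p + r e\<^bsup>iaz\<^esup>) \<Phi>(\<theta>z)\<close>, then \<open>e\<^bsup>izY\<^esup> \<Phi>(z \<theta>\<^bsup>N\<^esup>)\<close> is, up to an error quadratic in the mesh at each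
  step, a martingale that starts at \<open>\<Phi>(z)\<close> and tends to \<open>e\<^bsup>izY\<^esup>\<close>, so \<open>\<Phi>\<close> is the characteristic function.

  Because \<open>p < r\<close>, the logarithm of \<open>p + r e\<^bsup>iaz\<^esup> = r e\<^bsup>iaz\<^esup> (1 + (p/r) e\<^bsup>-iaz\<^esup>)\<close> expands into a drift and
  atoms at the negative points \<open>-a(m+1)\<close>. Scaling by \<open>\<theta>\<^sup>n\<close> and summing over \<open>n\<close> gives the exponent for
  \<open>\<theta> = 1/c\<close>; there atoms can collide with opposite signs, hence the Jordan decomposition.\<close>

section \<open>Signed measures with countably many atoms\<close>

text \<open>The functional equation is what regeneration at the first jump of \<open>N\<close>
  predicts: at that jump \<open>L\<close> gains a with probability r and 0 with probability p, and
  the remaining integral is \<theta> times an independent copy of the whole. Regeneration at a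
  random time is a statement about stopping times, while the process is specified by its increments
  between deterministic times and by cadlag paths. So the equation is used in the opposite
  direction: an explicit solution \<Phi> is written down, and short deterministic intervals identify
  it. Over an interval of length t the first order term is t times (u + w exp(iaz))
  \<Phi>(\<theta>z) - (u + w) \<Phi>(z), which vanishes, and the remainder is bounded by the second
  factorial moment of a Poisson variable, of order t^2. The grid of level n has mesh 2^-n and
  reaches time n; its n 2^n steps contribute n 2^-n in total, which still tends to 0 although the
  horizon grows.

  The exponents need no compensating term: weight times position is absolutely summable over the
  atoms, so exp(izx) - 1 is integrable against both parts even where the total mass near 0 is
  infinite.\<close>

lemma discrete_jordan_decomposition:
  fixes \<nu>1 \<nu>2 :: "real measure"
  assumes sets: "sets \<nu>1 = sets borel" "sets \<nu>2 = sets borel"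
    and S: "countable S"
    and null: "emeasure \<nu>1 (- S) = 0" "emeasure \<nu>2 (- S) = 0"
    and fin: "\<And>y. y \<in> S \<Longrightarrow> emeasure \<nu>1 {y} < \<infinity>" "\<And>y. y \<in> S \<Longrightarrow> emeasure \<nu>2 {y} < \<infinity>"
  obtains \<nu>p \<nu>m where
    "sets \<nu>p = sets borel" "sets \<nu>m = sets borel" "mutually_singular \<nu>p \<nu>m"
    "\<nu>p \<le> \<nu>1" "\<nu>m \<le> \<nu>2"
    "\<And>g. integrable \<nu>1 g \<Longrightarrow> integrable \<nu>2 g \<Longrightarrow>
      signed_integrable \<nu>p \<nu>m g \<and> signed_integral \<nu>p \<nu>m g = signed_integral \<nu>1 \<nu>2 g"
proof -
  define atm where "atm f = distr (density (count_space S) (\<lambda>y. ennreal (f y))) borel (\<lambda>y. y)"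
    for f :: "real \<Rightarrow> real"
  have sets_at [simp]: "sets (atm f) = sets borel" for f
    by (simp add: atm_def)
  have space_at [simp]: "space (atm f) = UNIV" for f
    by (simp add: atm_def)
  have emeasure_at: "emeasure (atm f) A = (\<integral>\<^sup>+ y. ennreal (f y) * indicator A y \<partial>count_space S)"
    if "A \<in> sets borel" for f A
  proof -
    have "emeasure (atm f) A = emeasure (density (count_space S) (\<lambda>y. ennreal (f y))) (A \<inter> S)"
      using that by (simp add: atm_def emeasure_distr)
    also have "\<dots> = (\<integral>\<^sup>+ y. ennreal (f y) * indicator (A \<inter> S) y \<partial>count_space S)"
      by (subst emeasure_density) auto
    also have "\<dots> = (\<integral>\<^sup>+ y. ennreal (f y) * indicator A y \<partial>count_space S)"
      by (intro nn_integral_cong) (auto simp: indicator_def)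
    finally show ?thesis .
  qed
  have at_mono: "atm f \<le> atm g" if "\<And>y. y \<in> S \<Longrightarrow> f y \<le> g y" for f g
    using that
    by (subst le_measure) (auto simp: emeasure_at intro!: nn_integral_mono mult_right_mono ennreal_leI)
  have integrable_at: "integrable (atm f) g \<longleftrightarrow> integrable (count_space S) (\<lambda>y. f y *\<^sub>R g y)"
    if "\<And>y. f y \<ge> 0" "g \<in> borel_measurable borel" for f and g :: "real \<Rightarrow> complex"
    unfolding atm_def using that by (subst integrable_distr_eq) (auto simp: integrable_density)
  have integral_at: "integral\<^sup>L (atm f) g = integral\<^sup>L (count_space S) (\<lambda>y. f y *\<^sub>R g y)"
    if "\<And>y. f y \<ge> 0" "g \<in> borel_measurable borel" for f and g :: "real \<Rightarrow> complex"
    unfolding atm_def using that by (subst integral_distr) (auto simp: integral_density)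
  \<comment> \<open>A measure that lives on the countable set \<open>S\<close> with finite point
    masses is determined by them, so both given measures become densities on one counting measure
    and can be compared pointwise.\<close>
  have eq_at: "\<nu> = atm (\<lambda>y. measure \<nu> {y})"
    if "sets \<nu> = sets borel" "emeasure \<nu> (- S) = 0" "\<And>y. y \<in> S \<Longrightarrow> emeasure \<nu> {y} < \<infinity>" for \<nu>
  proof (rule measure_eqI)
    fix A assume "A \<in> sets \<nu>"
    then have A: "A \<in> sets borel" using that by simp
    have cS: "B \<in> sets \<nu>" if "B \<subseteq> S" for B
      using countable_subset[OF that S] by (simp add: \<open>sets \<nu> = _\<close> sets.countable)
    have "emeasure \<nu> A = emeasure \<nu> (A \<inter> S)"
    proof (rule emeasure_eq_AE)
      have "- S \<in> null_sets \<nu>"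
        using that cS[of S] by (auto simp: null_sets_def)
      from AE_not_in[OF this] show "AE y in \<nu>. (y \<in> A) = (y \<in> A \<inter> S)"
        by eventually_elim auto
    qed (use \<open>A \<in> sets \<nu>\<close> cS in auto)
    also have "\<dots> = (\<integral>\<^sup>+ y. emeasure \<nu> {y} \<partial>count_space (A \<inter> S))"
      using S cS by (intro emeasure_countable_singleton) auto
    also have "\<dots> = (\<integral>\<^sup>+ y. emeasure \<nu> {y} * indicator A y \<partial>count_space S)"
      by (subst nn_integral_count_space_indicator, simp,
          subst (2) nn_integral_count_space_indicator, simp)
        (auto intro!: nn_integral_cong simp: indicator_def)
    also have "\<dots> = (\<integral>\<^sup>+ y. ennreal (measure \<nu> {y}) * indicator A y \<partial>count_space S)"
      using that(3) by (intro nn_integral_cong) (simp add: emeasure_eq_ennreal_measure less_top)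
    also have "\<dots> = emeasure (atm (\<lambda>y. measure \<nu> {y})) A"
      using A by (simp add: emeasure_at)
    finally show "emeasure \<nu> A = emeasure (atm (\<lambda>y. measure \<nu> {y})) A" .
  qed (simp add: that)
  define f1 f2 where "f1 y = measure \<nu>1 {y}" and "f2 y = measure \<nu>2 {y}" for y
  have n1: "\<nu>1 = atm f1" and n2: "\<nu>2 = atm f2"
    unfolding f1_def f2_def using assms by (auto intro!: eq_at)
  have nonneg: "f1 y \<ge> 0" "f2 y \<ge> 0" for y by (auto simp: f1_def f2_def)
  \<comment> \<open>Removing the common mass min(f1, f2) at each point keeps the difference f1 - f2
    and leaves at most one of \<open>p\<close>, \<open>m\<close> nonzero there. The points with f1 >
    f2 carry \<open>p\<close>, all others carry \<open>m\<close>; this is the separating set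
    below.\<close>
  define p m where "p y = max 0 (f1 y - f2 y)" and "m y = max 0 (f2 y - f1 y)" for y
  have pm: "0 \<le> p y" "0 \<le> m y" "p y \<le> f1 y" "m y \<le> f2 y" "p y - m y = f1 y - f2 y" for y
    using nonneg by (auto simp: p_def m_def max_def)
  show ?thesis
  proof (rule that[of "atm p" "atm m"])
    have B: "{y\<in>S. f1 y > f2 y} \<in> sets borel"
      by (rule sets.countable) (auto intro: countable_subset[OF _ S])
    then have A: "- {y\<in>S. f1 y > f2 y} \<in> sets borel" by (rule borel_comp)
    show "mutually_singular (atm p) (atm m)"
      unfolding mutually_singular_def
    proof (rule bexI[of _ "- {y\<in>S. f1 y > f2 y}"], rule conjI)
      show "emeasure (atm p) (- {y\<in>S. f1 y > f2 y}) = 0"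
        unfolding emeasure_at[OF A] by (intro nn_integral_zero' AE_I2) (auto simp: indicator_def p_def not_less ennreal_neg)
      show "emeasure (atm m) (- (- {y\<in>S. f1 y > f2 y})) = 0"
        by (subst double_compl, subst emeasure_at[OF B], intro nn_integral_zero' AE_I2)
          (auto simp: indicator_def m_def not_less ennreal_neg)
    qed (rule A)
    show "atm p \<le> \<nu>1" "atm m \<le> \<nu>2"
      unfolding n1 n2 using pm by (auto intro!: at_mono)
    show "signed_integrable (atm p) (atm m) g \<and> signed_integral (atm p) (atm m) g = signed_integral \<nu>1 \<nu>2 g"
      if "integrable \<nu>1 g" "integrable \<nu>2 g" for g
    proof -
      have g: "g \<in> borel_measurable borel"
        using borel_measurable_integrable[OF that(1)] sets(1) by (simp cong: measurable_cong_sets)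
      have i12: "integrable (count_space S) (\<lambda>y. f1 y *\<^sub>R g y)" "integrable (count_space S) (\<lambda>y. f2 y *\<^sub>R g y)"
        using that nonneg g by (auto simp: n1 n2 integrable_at)
      have ipm: "integrable (count_space S) (\<lambda>y. p y *\<^sub>R g y)" "integrable (count_space S) (\<lambda>y. m y *\<^sub>R g y)"
        by (rule Bochner_Integration.integrable_bound[OF i12(1)]
            Bochner_Integration.integrable_bound[OF i12(2)]; use pm nonneg in \<open>auto intro!: mult_right_mono\<close>)+
      have "(\<lambda>y. p y *\<^sub>R g y - m y *\<^sub>R g y) = (\<lambda>y. f1 y *\<^sub>R g y - f2 y *\<^sub>R g y)"
        by (simp add: pm(5) flip: scaleR_diff_left)
      then show ?thesis
        unfolding signed_integrable_def signed_integral_def n1 n2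
        using pm nonneg g i12 ipm
        by (simp add: integrable_at integral_at flip: Bochner_Integration.integral_diff)
    qed
  qed auto
qed

lemma signed_integral_diff:
  assumes "signed_integrable \<nu>p \<nu>m f" "signed_integrable \<nu>p \<nu>m g"
  shows "signed_integral \<nu>p \<nu>m (\<lambda>x. f x - g x) = signed_integral \<nu>p \<nu>m f - signed_integral \<nu>p \<nu>m g"
  using assms by (simp add: signed_integral_def signed_integrable_def)

lemma norm_iexp_diff_le: "norm (iexp x - iexp y) \<le> \<bar>x - y\<bar>"
proof -
  have "iexp x - iexp y = iexp y * (iexp (x - y) - 1)"
    by (simp add: algebra_simps flip: exp_add)
  then have "norm (iexp x - iexp y) = norm (iexp (x - y) - 1)"
    by (simp add: norm_mult)
  also have "\<dots> \<le> \<bar>x - y\<bar>"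
    using iexp_approx1[of "x - y" 0] by simp
  finally show ?thesis .
qed

text \<open>Splitting \<open>b\<close> by sign is not enough for singularity, since indices with
  opposite signs may share the same point \<open>x i\<close>; the Jordan decomposition repairs this.
  The hypothesis is a first absolute moment condition and does three jobs: it makes every point mass
  finite, it dominates min(x^2, 1) because that is at most |x|, and it makes every \<open>g\<close>
  of linear growth integrable.\<close>

lemma discrete_signed_measure:
  fixes b x :: "'i::countable \<Rightarrow> real"
  assumes neg: "\<And>i. x i < 0"
    and int: "integrable (count_space UNIV) (\<lambda>i. b i * x i)"
  obtains \<nu>p \<nu>m where
    "sets \<nu>p = sets borel" "sets \<nu>m = sets borel" "mutually_singular \<nu>p \<nu>m"
    "signed_concentrated_on \<nu>p \<nu>m {..<0}"
    "(\<integral>\<^sup>+ x. ennreal (min (x\<^sup>2) 1) \<partial>\<nu>p) < \<infinity>" "(\<integral>\<^sup>+ x. ennreal (min (x\<^sup>2) 1) \<partial>\<nu>m) < \<infinity>"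
    "\<And>g C. g \<in> borel_measurable borel \<Longrightarrow> (\<And>y. norm (g y) \<le> C * \<bar>y\<bar>) \<Longrightarrow>
      signed_integrable \<nu>p \<nu>m g \<and>
      signed_integral \<nu>p \<nu>m g = (CLINT i|count_space UNIV. b i *\<^sub>R g (x i))"
proof -
  define atm where "atm f = distr (density (count_space UNIV) (\<lambda>i. ennreal (f i))) borel x"
    for f :: "'i \<Rightarrow> real"
  define f1 f2 where "f1 i = max 0 (b i)" and "f2 i = max 0 (- b i)" for i
  have f12: "0 \<le> f1 i" "0 \<le> f2 i" "f1 i \<le> \<bar>b i\<bar>" "f2 i \<le> \<bar>b i\<bar>" "f1 i - f2 i = b i" for i
    by (auto simp: f1_def f2_def max_def)
  have sets_at [simp]: "sets (atm f) = sets borel" for f by (simp add: atm_def)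
  have space_at [simp]: "space (atm f) = UNIV" for f by (simp add: atm_def)
  have nn_at: "(\<integral>\<^sup>+ y. g y \<partial>atm f) = (\<integral>\<^sup>+ i. ennreal (f i) * g (x i) \<partial>count_space UNIV)"
    if "g \<in> borel_measurable borel" for f g
    unfolding atm_def using that by (simp add: nn_integral_distr nn_integral_density)
  have emeasure_at: "emeasure (atm f) A = (\<integral>\<^sup>+ i. ennreal (f i) * indicator A (x i) \<partial>count_space UNIV)"
    if "A \<in> sets borel" for f A
    using nn_at[of "indicator A" f] that by simp
  have fin_abs: "(\<integral>\<^sup>+ y. ennreal \<bar>y\<bar> \<partial>atm f) < \<infinity>" if "\<And>i. 0 \<le> f i" "\<And>i. f i \<le> \<bar>b i\<bar>" for f
  proof -
    have "(\<integral>\<^sup>+ y. ennreal \<bar>y\<bar> \<partial>atm f) \<le> (\<integral>\<^sup>+ i. ennreal (norm (b i * x i)) \<partial>count_space UNIV)"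
      using that by (subst nn_at) (auto intro!: nn_integral_mono mult_right_mono simp: abs_mult simp flip: ennreal_mult)
    also have "\<dots> < \<infinity>"
      using int by (simp add: integrable_iff_bounded)
    finally show ?thesis .
  qed
  \<comment> \<open>Markov's inequality at one point: the mass of y is at most the first absolute
    moment divided by |y|. All points \<open>x i\<close> are negative, so y = 0 does not
    arise.\<close>
  have fin_pt: "emeasure (atm f) {y} < \<infinity>" if "y \<noteq> 0" "\<And>i. 0 \<le> f i" "\<And>i. f i \<le> \<bar>b i\<bar>" for f y
  proof -
    have "ennreal \<bar>y\<bar> * emeasure (atm f) {y} = (\<integral>\<^sup>+ z. ennreal \<bar>y\<bar> * indicator {y} z \<partial>atm f)"
      by (subst nn_integral_cmult_indicator) auto
    also have "\<dots> \<le> (\<integral>\<^sup>+ z. ennreal \<bar>z\<bar> \<partial>atm f)"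
      by (intro nn_integral_mono) (auto simp: indicator_def)
    also have "\<dots> < \<infinity>" using that by (intro fin_abs)
    finally show ?thesis
      using that(1) by (auto simp: ennreal_mult_less_top)
  qed
  have null: "emeasure (atm f) (- range x) = 0" for f
  proof -
    have "range x \<in> sets borel" by (rule sets.countable) auto
    then have "- range x \<in> sets borel" by (rule borel_comp)
    moreover have "(\<integral>\<^sup>+ i. ennreal (f i) * indicator (- range x) (x i) \<partial>count_space UNIV) = 0"
      by (intro nn_integral_zero') simp
    ultimately show ?thesis
      by (simp only: emeasure_at)
  qed
  have null0: "emeasure (atm f) (- {..<0}) = 0" for f
  proof -
    have "(\<integral>\<^sup>+ i. ennreal (f i) * indicator (- {..<0}) (x i) \<partial>count_space UNIV) = 0"
      using neg by (intro nn_integral_zero' AE_I2) (simp add: indicator_def not_le)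
    then show ?thesis by (subst emeasure_at) simp_all
  qed
  have int_at: "integrable (atm f) g \<and> integrable (count_space UNIV) (\<lambda>i. f i *\<^sub>R g (x i))"
    if "\<And>i. 0 \<le> f i" "\<And>i. f i \<le> \<bar>b i\<bar>" "g \<in> borel_measurable borel" "\<And>y. norm (g y) \<le> C * \<bar>y\<bar>"
    for f C and g :: "real \<Rightarrow> complex"
  proof -
    have "integrable (count_space UNIV) (\<lambda>i. f i *\<^sub>R g (x i))"
    proof (rule Bochner_Integration.integrable_bound)
      show "integrable (count_space UNIV) (\<lambda>i. C * (b i * x i))" using int by simp
      have "norm (f i *\<^sub>R g (x i)) \<le> norm (C * (b i * x i))" for i
      proof -
        have "0 \<le> C" using order_trans[OF norm_ge_zero that(4)[of 1]] by simp
        have "norm (f i *\<^sub>R g (x i)) \<le> \<bar>b i\<bar> * (C * \<bar>x i\<bar>)"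
          using that by (auto intro!: mult_mono)
        then show ?thesis using \<open>0 \<le> C\<close> by (simp add: abs_mult mult_ac)
      qed
      then show "AE i in count_space UNIV. norm (f i *\<^sub>R g (x i)) \<le> norm (C * (b i * x i))" by simp
    qed simp
    then show ?thesis
      using that unfolding atm_def by (auto simp: integrable_distr_eq integrable_density)
  qed
  have integral_at: "integral\<^sup>L (atm f) g = (CLINT i|count_space UNIV. f i *\<^sub>R g (x i))"
    if "\<And>i. 0 \<le> f i" "g \<in> borel_measurable borel" for f and g :: "real \<Rightarrow> complex"
    unfolding atm_def using that by (simp add: integral_distr integral_density)
  obtain \<nu>p \<nu>m where \<nu>: "sets \<nu>p = sets borel" "sets \<nu>m = sets borel" "mutually_singular \<nu>p \<nu>m"
    "\<nu>p \<le> atm f1" "\<nu>m \<le> atm f2"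
    "\<And>g :: real \<Rightarrow> complex. integrable (atm f1) g \<Longrightarrow> integrable (atm f2) g \<Longrightarrow>
      signed_integrable \<nu>p \<nu>m g \<and> signed_integral \<nu>p \<nu>m g = signed_integral (atm f1) (atm f2) g"
  proof (rule discrete_jordan_decomposition[of "atm f1" "atm f2" "range x"])
    fix y assume "y \<in> range x"
    then have "y \<noteq> 0" using neg by (metis imageE less_irrefl)
    then show "emeasure (atm f1) {y} < \<infinity>" "emeasure (atm f2) {y} < \<infinity>"
      by (rule fin_pt; simp add: f12)+
  qed (use null in auto)
  have sq: "(\<integral>\<^sup>+ x. ennreal (min (x\<^sup>2) 1) \<partial>\<nu>) < \<infinity>"
    if "\<nu> \<le> atm f" "sets \<nu> = sets borel" "\<And>i. 0 \<le> f i" "\<And>i. f i \<le> \<bar>b i\<bar>" for \<nu> f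
  proof -
    have "min (y\<^sup>2) 1 \<le> \<bar>y\<bar>" for y :: real
    proof (cases "\<bar>y\<bar> \<le> 1")
      case True
      then have "\<bar>y\<bar> * \<bar>y\<bar> \<le> 1 * \<bar>y\<bar>" by (intro mult_right_mono) auto
      then show ?thesis by (simp add: power2_eq_square)
    qed auto
    then have "(\<integral>\<^sup>+ x. ennreal (min (x\<^sup>2) 1) \<partial>\<nu>) \<le> (\<integral>\<^sup>+ y. ennreal \<bar>y\<bar> \<partial>\<nu>)"
      by (intro nn_integral_mono ennreal_leI)
    also have "\<dots> \<le> (\<integral>\<^sup>+ y. ennreal \<bar>y\<bar> \<partial>atm f)"
      using that by (intro nn_integral_mono_measure) auto
    also have "\<dots> < \<infinity>" using that by (intro fin_abs)
    finally show ?thesis .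
  qed
  have le0: "emeasure \<nu> (- {..<0}) = 0" if "\<nu> \<le> atm f" "sets \<nu> = sets borel" for \<nu> f
    using le_measureD3[OF that(1)] that(2) null0[of f] by (metis le_zero_eq sets_at)
  show ?thesis
  proof (rule that[of \<nu>p \<nu>m])
    show "signed_concentrated_on \<nu>p \<nu>m {..<0}"
      unfolding signed_concentrated_on_def using \<nu> le0 by auto
    show "(\<integral>\<^sup>+ x. ennreal (min (x\<^sup>2) 1) \<partial>\<nu>p) < \<infinity>" using \<nu> f12 by (intro sq[of _ f1])
    show "(\<integral>\<^sup>+ x. ennreal (min (x\<^sup>2) 1) \<partial>\<nu>m) < \<infinity>" using \<nu> f12 by (intro sq[of _ f2])
    fix g :: "real \<Rightarrow> complex" and C assume g: "g \<in> borel_measurable borel" "\<And>y. norm (g y) \<le> C * \<bar>y\<bar>"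
    have i: "integrable (atm f1) g" "integrable (atm f2) g"
        "integrable (count_space UNIV) (\<lambda>i. f1 i *\<^sub>R g (x i))"
        "integrable (count_space UNIV) (\<lambda>i. f2 i *\<^sub>R g (x i))"
      using int_at[OF _ _ g] f12 by auto
    have "signed_integral (atm f1) (atm f2) g = (CLINT i|count_space UNIV. b i *\<^sub>R g (x i))"
      unfolding signed_integral_def using i g f12
      by (simp add: integral_at f12(5) flip: Bochner_Integration.integral_diff scaleR_diff_left)
    then show "signed_integrable \<nu>p \<nu>m g \<and>
      signed_integral \<nu>p \<nu>m g = (CLINT i|count_space UNIV. b i *\<^sub>R g (x i))"
      using \<nu>(6)[OF i(1,2)] by simp
  qed (use \<nu> in auto)
qed

text \<open>An exponent given as a sum over atoms already determines the signed measure. What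
  remains is to pass to the truncated integrand of the general representation, which only shifts the
  drift, since the truncation function is bounded by |y| and hence integrable against both
  parts.\<close>

lemma quasi_levy_of_discrete_exponent:
  fixes b x :: "'i::countable \<Rightarrow> real" and d :: real and \<sigma> :: "real measure"
  assumes neg: "\<And>i. x i < 0"
    and int: "integrable (count_space UNIV) (\<lambda>i. b i * x i)"
    and char: "\<And>z. char \<sigma> z =
      exp ((CLINT i|count_space UNIV. b i *\<^sub>R (iexp (z * x i) - 1)) + \<i> * of_real d * of_real z)"
  shows "\<exists>\<nu>p \<nu>m. is_quasi_levy_measure \<sigma> \<nu>p \<nu>m \<and>
      (\<forall>z. signed_integrable \<nu>p \<nu>m (\<lambda>x. iexp (z * x) - 1) \<and>
        char \<sigma> z =
          exp (signed_integral \<nu>p \<nu>m (\<lambda>x. iexp (z * x) - 1) + \<i> * of_real d * of_real z)) \<and>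
      signed_concentrated_on \<nu>p \<nu>m {..<0}"
proof (rule discrete_signed_measure[OF neg int])
  fix \<nu>p \<nu>m
  assume \<nu>: "sets \<nu>p = sets borel" "sets \<nu>m = sets borel" "mutually_singular \<nu>p \<nu>m"
    "signed_concentrated_on \<nu>p \<nu>m {..<0}"
    "(\<integral>\<^sup>+ x. ennreal (min (x\<^sup>2) 1) \<partial>\<nu>p) < \<infinity>" "(\<integral>\<^sup>+ x. ennreal (min (x\<^sup>2) 1) \<partial>\<nu>m) < \<infinity>"
    and g: "\<And>g C. g \<in> borel_measurable borel \<Longrightarrow> (\<And>y. norm (g y) \<le> C * \<bar>y\<bar>) \<Longrightarrow>
      signed_integrable \<nu>p \<nu>m g \<and>
      signed_integral \<nu>p \<nu>m g = (CLINT i|count_space UNIV. b i *\<^sub>R g (x i))"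
  have e: "signed_integrable \<nu>p \<nu>m (\<lambda>x. iexp (z * x) - 1)"
      "signed_integral \<nu>p \<nu>m (\<lambda>x. iexp (z * x) - 1) = (CLINT i|count_space UNIV. b i *\<^sub>R (iexp (z * x i) - 1))"
    for z
    using g[of "\<lambda>x. iexp (z * x) - 1" "\<bar>z\<bar>"] norm_iexp_diff_le[of "z * y" 0 for y]
    by (auto simp: abs_mult)
  define h where "h y = y * indicator {-1..1} y" for y :: real
  have h: "signed_integrable \<nu>p \<nu>m (\<lambda>y. \<i> * of_real (z * h y))" for z
    using g[of "\<lambda>y. \<i> * of_real (z * h y)" "\<bar>z\<bar>"]
    by (auto simp: norm_mult abs_mult h_def indicator_def mult_left_mono)
  \<comment> \<open>Truncation subtracts iz times the signed integral of \<open>h\<close> from the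
    exponent; adding that integral to the drift \<open>d\<close> compensates. The Gaussian
    coefficient is 0.\<close>
  define \<gamma> where "\<gamma> = d + ((LINT y|\<nu>p. h y) - (LINT y|\<nu>m. h y))"
  have hi: "signed_integral \<nu>p \<nu>m (\<lambda>y. \<i> * of_real (z * h y)) = \<i> * of_real (z * (\<gamma> - d))" for z
    by (simp add: signed_integral_def \<gamma>_def algebra_simps)
  have trunc: "signed_integral \<nu>p \<nu>m (\<lambda>x. iexp (z * x) - 1 - \<i> * of_real (z * x * indicator {-1..1} x))
     = signed_integral \<nu>p \<nu>m (\<lambda>x. iexp (z * x) - 1) - \<i> * of_real (z * (\<gamma> - d))" for z
    using signed_integral_diff[OF e(1)[of z] h[of z]] unfolding hi by (simp add: h_def mult.assoc)
  have "char \<sigma> z = exp (\<i> * of_real (\<gamma> * z) - of_real (0 * z\<^sup>2) +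
         signed_integral \<nu>p \<nu>m (\<lambda>x. iexp (z * x) - 1 - \<i> * of_real (z * x * indicator {-1..1} x)))" for z
    unfolding trunc char e(2) by (rule arg_cong[where f=exp]) (simp add: algebra_simps)
  moreover have "emeasure \<nu>p {0} = 0" "emeasure \<nu>m {0} = 0"
    using \<nu>(4) emeasure_mono[of "{0}" "- {..<0}" \<nu>p] emeasure_mono[of "{0}" "- {..<0}" \<nu>m] \<nu>(1,2)
    by (auto simp: signed_concentrated_on_def)
  ultimately have "is_quasi_levy_measure \<sigma> \<nu>p \<nu>m"
    unfolding is_quasi_levy_measure_def using \<nu> by blast
  then show ?thesis
    by (intro exI[of _ \<nu>p] exI[of _ \<nu>m] conjI allI \<nu>(4) e(1)) (simp_all only: char e(2))
qed

section \<open>Step paths on dyadic grids\<close>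

definition dyadic :: "nat \<Rightarrow> nat \<Rightarrow> real" where
  "dyadic n i = real i / 2 ^ n"

lemma dyadic_0 [simp]: "dyadic n 0 = 0"
  and dyadic_nonneg [simp]: "0 \<le> dyadic n i"
  and dyadic_le_iff [simp]: "dyadic n i \<le> dyadic n j \<longleftrightarrow> i \<le> j"
  and dyadic_less_iff [simp]: "dyadic n i < dyadic n j \<longleftrightarrow> i < j"
  and dyadic_Suc: "dyadic n (Suc i) = dyadic n i + 1 / 2 ^ n"
  and dyadic_end: "dyadic n (n * 2 ^ n) = real n"
  by (auto simp: dyadic_def field_simps)

text \<open>Left-endpoint Riemann sum for the integral of \<theta>^f(s-) against dg. A power with
  natural exponent admits \<theta> = 0 with \<open>0 ^ 0 = 1\<close>, whereas
  \<open>0 powr 0 = 0\<close> would lose the first jump.\<close>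

definition dyadic_sum :: "real \<Rightarrow> (real \<Rightarrow> real) \<Rightarrow> (real \<Rightarrow> real) \<Rightarrow> nat \<Rightarrow> nat \<Rightarrow> real" where
  "dyadic_sum \<theta> f g n m =
     (\<Sum>i<m. \<theta> ^ nat \<lfloor>f (dyadic n i)\<rfloor> * (g (dyadic n (Suc i)) - g (dyadic n i)))"

text \<open>The deterministic properties shared by almost all paths. The increment conditions are
  imposed on dyadic points only, because they come from countably many almost sure statements; right
  continuity extends them to all times. \<open>small_incr\<close> says that fine cells contain at
  most one unit step of \<open>f\<close>, over a horizon that grows with n.\<close>

locale stepping_path =
  fixes f g :: "real \<Rightarrow> real" and a :: real
  assumes a_nonneg: "0 \<le> a"
    and start: "f 0 = 0" "g 0 = 0"
    and right_cont: "\<And>t. 0 \<le> t \<Longrightarrow> continuous (at_right t) f" "\<And>t. 0 \<le> t \<Longrightarrow> continuous (at_right t) g"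
    and left_lim: "\<And>t. 0 < t \<Longrightarrow> \<exists>l. (f \<longlongrightarrow> l) (at_left t)"
    and incr_f: "\<And>n i. f (dyadic n (Suc i)) - f (dyadic n i) \<in> \<nat>"
    and incr_g: "\<And>n i. 0 \<le> g (dyadic n (Suc i)) - g (dyadic n i)"
      "\<And>n i. g (dyadic n (Suc i)) - g (dyadic n i) \<le> a * (f (dyadic n (Suc i)) - f (dyadic n i))"
    and small_incr: "eventually (\<lambda>n. \<forall>i<n * 2 ^ n. f (dyadic n (Suc i)) - f (dyadic n i) \<le> 1) sequentially"
begin

lemma incr_f_nonneg: "0 \<le> f (dyadic n (Suc i)) - f (dyadic n i)"
  using incr_f[of n i] by (auto elim: Nats_cases)

lemma dyadic_props:
  assumes "i \<le> j"
  shows "f (dyadic n i) \<in> \<int> \<and> f (dyadic n i) \<le> f (dyadic n j) \<and>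
    g (dyadic n i) \<le> g (dyadic n j)"
proof -
  have ints: "f (dyadic n i) \<in> \<int>" for i
  proof (induction i)
    case (Suc i)
    then have "f (dyadic n i) + (f (dyadic n (Suc i)) - f (dyadic n i)) \<in> \<int>"
      using incr_f[of n i] Nats_subset_Ints by (intro Ints_add) auto
    then show ?case by simp
  qed (simp add: start)
  show ?thesis
    using assms
  proof (induction j rule: dec_induct)
    case (step j)
    then show ?case
      using incr_f_nonneg[of n j] incr_g[of n j] by (auto simp: algebra_simps)
  qed (use ints in auto)
qed

text \<open>The successor makes the grid point lie strictly to the right of t, even when t itself is
  dyadic, so right continuity applies through \<open>at_right t\<close>.\<close>

definition next_dyadic :: "nat \<Rightarrow> real \<Rightarrow> nat" where
  "next_dyadic n t = Suc (nat \<lfloor>t * 2 ^ n\<rfloor>)"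

lemma next_dyadic:
  assumes "0 \<le> t"
  shows "t < dyadic n (next_dyadic n t)" "dyadic n (next_dyadic n t) \<le> t + 1 / 2 ^ n"
proof -
  have "real (nat \<lfloor>t * 2 ^ n\<rfloor>) = of_int \<lfloor>t * 2 ^ n\<rfloor>" using assms by simp
  moreover have "of_int \<lfloor>t * 2 ^ n\<rfloor> \<le> t * 2 ^ n" "t * 2 ^ n < of_int \<lfloor>t * 2 ^ n\<rfloor> + 1" by linarith+
  ultimately show "t < dyadic n (next_dyadic n t)" "dyadic n (next_dyadic n t) \<le> t + 1 / 2 ^ n"
    unfolding dyadic_def next_dyadic_def by (auto simp: field_simps)
qed

lemma next_dyadic_mono: "s \<le> t \<Longrightarrow> next_dyadic n s \<le> next_dyadic n t"
  unfolding next_dyadic_def by (auto intro!: nat_mono floor_mono)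

lemma tendsto_add_inverse_power_two: "(\<lambda>n. t + 1 / 2 ^ n) \<longlonglongrightarrow> (t::real)"
  using tendsto_add[OF tendsto_const LIMSEQ_power_zero[of "1 / 2 :: real"], of t]
  by (simp add: power_one_over)

lemma filterlim_next_dyadic:
  assumes "0 \<le> t"
  shows "filterlim (\<lambda>n. dyadic n (next_dyadic n t)) (at_right t) sequentially"
  unfolding filterlim_at
proof
  show "(\<lambda>n. dyadic n (next_dyadic n t)) \<longlonglongrightarrow> t"
    by (rule tendsto_sandwich[OF _ _ tendsto_const tendsto_add_inverse_power_two[of t]])
      (use next_dyadic[OF assms] in \<open>auto intro!: always_eventually less_imp_le\<close>)
qed (use next_dyadic[OF assms] in \<open>auto simp: less_imp_neq[symmetric] intro!: always_eventually\<close>)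

lemma tendsto_next_dyadic:
  assumes "0 \<le> t"
  shows "(\<lambda>n. f (dyadic n (next_dyadic n t))) \<longlonglongrightarrow> f t" "(\<lambda>n. g (dyadic n (next_dyadic n t))) \<longlonglongrightarrow> g t"
  using right_cont[OF assms] filterlim_next_dyadic[OF assms]
  by (auto simp: continuous_within intro: filterlim_compose)

text \<open>Monotonicity holds between grid points of the same level; the indices of the next grid
  points are ordered like s and t, and right continuity carries the inequality to the limit.\<close>

lemma path_props:
  assumes "0 \<le> s" "s \<le> t"
  shows f_mono: "f s \<le> f t" and g_mono: "g s \<le> g t"
proof -
  note p = dyadic_props[OF next_dyadic_mono[OF assms(2)]]
  note l = tendsto_next_dyadic[OF assms(1)] tendsto_next_dyadic[OF order_trans[OF assms]]
  show "f s \<le> f t" by (rule LIMSEQ_le[OF l(1,3)]) (use p in blast)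
  show "g s \<le> g t" by (rule LIMSEQ_le[OF l(2,4)]) (use p in blast)
qed

lemma f_Ints: "0 \<le> t \<Longrightarrow> f t \<in> \<int>"
  by (rule closed_sequentially[OF closed_Ints _ tendsto_next_dyadic(1)])
    (use dyadic_props[OF order_refl] in auto)

lemma f_nonneg: "0 \<le> t \<Longrightarrow> 0 \<le> f t"
  using path_props[of 0 t] by (auto simp: start)

lemma real_nat_floor_f: "0 \<le> t \<Longrightarrow> real (nat \<lfloor>f t\<rfloor>) = f t"
  using f_Ints[of t] f_nonneg[of t] by (auto elim: Ints_cases)

text \<open>If \<open>f\<close> moves by 0 or 1 across a cell, then \<theta>^k times its increment
  equals (\<theta>^k - \<theta>^k') / (1 - \<theta>), with k and k' the values at the two ends.
  Since \<open>g\<close> moves by at most \<open>a\<close> times as much, the sum telescopes. The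
  constant a / (1 - \<theta>) is the geometric series a + a \<theta> + a \<theta>^2 + ..., reached
  when every step of \<open>f\<close> carries a full step \<open>a\<close> of
  \<open>g\<close>.\<close>

lemma dyadic_sum_bounds:
  assumes \<theta>: "0 \<le> \<theta>" "\<theta> < 1"
    and small: "\<forall>i<m. f (dyadic n (Suc i)) - f (dyadic n i) \<le> 1"
  shows "0 \<le> dyadic_sum \<theta> f g n m" "dyadic_sum \<theta> f g n m \<le> a / (1 - \<theta>)"
proof -
  define k where "k i = nat \<lfloor>f (dyadic n i)\<rfloor>" for i
  have k: "real (k i) = f (dyadic n i)" for i
    unfolding k_def by (simp add: real_nat_floor_f)
  show "0 \<le> dyadic_sum \<theta> f g n m"
    unfolding dyadic_sum_def using \<theta> incr_g by (auto intro!: sum_nonneg)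
  have "dyadic_sum \<theta> f g n m \<le> (\<Sum>i<m. a / (1 - \<theta>) * (\<theta> ^ k i - \<theta> ^ k (Suc i)))"
    unfolding dyadic_sum_def k_def[symmetric]
  proof (rule sum_mono)
    fix i assume "i \<in> {..<m}"
    then have "f (dyadic n (Suc i)) - f (dyadic n i) \<le> 1" using small by auto
    then have "real (k (Suc i)) - real (k i) \<le> 1" "0 \<le> real (k (Suc i)) - real (k i)"
      using incr_f_nonneg[of n i] by (auto simp: k)
    then consider "k (Suc i) = k i" | "k (Suc i) = Suc (k i)" by linarith
    then have eq: "\<theta> ^ k i * (f (dyadic n (Suc i)) - f (dyadic n i)) = (\<theta> ^ k i - \<theta> ^ k (Suc i)) / (1 - \<theta>)"
      using \<theta> by cases (auto simp: k[symmetric] field_simps)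
    have "\<theta> ^ k i * (g (dyadic n (Suc i)) - g (dyadic n i))
       \<le> \<theta> ^ k i * (a * (f (dyadic n (Suc i)) - f (dyadic n i)))"
      using incr_g \<theta> by (intro mult_left_mono) auto
    also have "\<dots> = a / (1 - \<theta>) * (\<theta> ^ k i - \<theta> ^ k (Suc i))"
      using eq by (simp add: mult.left_commute[of _ a])
    finally show "\<theta> ^ k i * (g (dyadic n (Suc i)) - g (dyadic n i)) \<le> a / (1 - \<theta>) * (\<theta> ^ k i - \<theta> ^ k (Suc i))" .
  qed
  also have "\<dots> = a / (1 - \<theta>) * (\<theta> ^ k 0 - \<theta> ^ k m)"
    using sum_lessThan_telescope'[of "\<lambda>i. \<theta> ^ k i" m] by (simp only: flip: sum_distrib_left)
  also have "\<dots> \<le> a / (1 - \<theta>) * 1"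
    using \<theta> a_nonneg by (intro mult_left_mono) (auto simp: k_def start)
  finally show "dyadic_sum \<theta> f g n m \<le> a / (1 - \<theta>)" by simp
qed

text \<open>For \<theta> = 0 only cells whose left end precedes the first passage of
  \<open>f\<close> above 0 survive. Their increments telescope to the value of \<open>g\<close> at
  the first grid point not before that time, and right continuity of \<open>g\<close>
  finishes.\<close>

lemma tendsto_first_jump:
  assumes "0 \<le> t0" "f t0 > 0"
  shows "(\<lambda>n. dyadic_sum 0 f g n (n * 2 ^ n)) \<longlonglongrightarrow> g (first_jump_time f)"
proof -
  define S where "S = {t. 0 \<le> t \<and> f t > 0}"
  define T where "T = Inf S"
  have S: "S \<noteq> {}" "bdd_below S" using assms by (auto simp: S_def intro: bdd_belowI[of _ 0])
  have "0 \<le> T" unfolding T_def using S by (intro cInf_greatest) (auto simp: S_def)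
  have before: "f t = 0" if "0 \<le> t" "t < T" for t
    using cInf_lower[OF _ S(2), folded T_def, of t] that f_nonneg[of t]
    by (cases "f t > 0") (auto simp: S_def)
  have after: "f t > 0" if gt: "T < t" for t
  proof -
    obtain s where "s \<in> S" "s < t" using cInf_lessD[OF S(1), of t] gt unfolding T_def by auto
    then show ?thesis using f_mono[of s t] by (auto simp: S_def)
  qed
  \<comment> \<open>The infimum is attained: just to the right of T the values are positive
    integers, hence at least 1, and right continuity forbids a value below 1 at T.\<close>
  have fT: "f T > 0"
  proof (rule ccontr)
    assume "\<not> f T > 0"
    then have "f T < 1" by simp
    then have "eventually (\<lambda>n. f (dyadic n (next_dyadic n T)) < 1) sequentially"
      by (rule order_tendstoD(2)[OF tendsto_next_dyadic(1)[OF \<open>0 \<le> T\<close>]])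
    then obtain n where "f (dyadic n (next_dyadic n T)) < 1" by (auto simp: eventually_sequentially)
    moreover have "f (dyadic n (next_dyadic n T)) > 0"
      using next_dyadic[OF \<open>0 \<le> T\<close>] by (intro after)
    moreover have "f (dyadic n (next_dyadic n T)) \<in> \<int>" by (simp add: f_Ints)
    ultimately show False by (auto elim!: Ints_cases)
  qed
  then have "0 < T" using \<open>0 \<le> T\<close> start by (cases "T = 0") auto
  \<comment> \<open>Before T the path is constantly 0 and so equal to its left limits, while at T
    the left limit 0 differs from f T > 0. Thus T is the first time counted by
    \<open>first_jump_time\<close>.\<close>
  have left: "left_limit f t = 0" if "0 < t" "t \<le> T" for t
    unfolding left_limit_def
  proof (rule tendsto_Lim)
    have "eventually (\<lambda>s. f s = 0) (at_left t)"
      using eventually_at_left_real[OF that(1)] by eventually_elim (use that before in auto)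
    then show "(f \<longlongrightarrow> 0) (at_left t)" by (rule tendsto_eventually)
  qed simp
  have jump: "first_jump_time f = T"
    unfolding first_jump_time_def
  proof (rule cInf_eq_minimum)
    show "T \<in> {t. 0 < t \<and> left_limit f t \<noteq> f t}" using \<open>0 < T\<close> fT left[of T] by auto
    fix t assume "t \<in> {t. 0 < t \<and> left_limit f t \<noteq> f t}"
    then show "T \<le> t" using left[of t] before[of t] by (cases "t < T") auto
  qed
  \<comment> \<open>The ceiling selects the least index whose grid point is at or after T. It may
    hit T exactly, so the values of \<open>g\<close> are squeezed between g T and the value at the
    strictly later \<open>next_dyadic\<close> point.\<close>
  define m where "m n = nat \<lceil>T * 2 ^ n\<rceil>" for n
  have m_iff: "i < m n \<longleftrightarrow> dyadic n i < T" for n i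
    using \<open>0 \<le> T\<close> by (auto simp: m_def dyadic_def field_simps) linarith+
  have sum_eq: "dyadic_sum 0 f g n (n * 2 ^ n) = g (dyadic n (m n))" if "T \<le> real n" for n
  proof -
    have "m n \<le> n * 2 ^ n"
      using m_iff[of "n * 2 ^ n" n] that by (simp add: dyadic_end)
    have "dyadic_sum 0 f g n (n * 2 ^ n) = (\<Sum>i<m n. g (dyadic n (Suc i)) - g (dyadic n i))"
      unfolding dyadic_sum_def
    proof (rule sum.mono_neutral_cong_right)
      show "\<forall>i\<in>{..<n * 2 ^ n} - {..<m n}. 0 ^ nat \<lfloor>f (dyadic n i)\<rfloor> * (g (dyadic n (Suc i)) - g (dyadic n i)) = 0"
      proof
        fix i assume "i \<in> {..<n * 2 ^ n} - {..<m n}"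
        then have "T \<le> dyadic n i" using m_iff[of i n] by auto
        then have "f (dyadic n i) > 0" using f_mono[of T "dyadic n i"] fT \<open>0 \<le> T\<close> by simp
        then have "nat \<lfloor>f (dyadic n i)\<rfloor> > 0" using real_nat_floor_f[of "dyadic n i"] by (intro gr0I) simp
        then show "0 ^ nat \<lfloor>f (dyadic n i)\<rfloor> * (g (dyadic n (Suc i)) - g (dyadic n i)) = 0" by simp
      qed
    qed (use \<open>m n \<le> n * 2 ^ n\<close> m_iff before in auto)
    also have "\<dots> = g (dyadic n (m n)) - g (dyadic n 0)" by (rule sum_lessThan_telescope)
    finally show ?thesis by (simp add: start)
  qed
  have m_bounds: "T \<le> dyadic n (m n)" "m n \<le> next_dyadic n T" for n
    using m_iff[of "m n" n] m_iff[of "next_dyadic n T" n] next_dyadic[OF \<open>0 \<le> T\<close>, of n] by (auto simp: not_less)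
  have "(\<lambda>n. g (dyadic n (m n))) \<longlonglongrightarrow> g T"
    by (rule tendsto_sandwich[OF _ _ tendsto_const tendsto_next_dyadic(2)[OF \<open>0 \<le> T\<close>]])
      (use m_bounds \<open>0 \<le> T\<close> in \<open>auto intro!: always_eventually g_mono\<close>)
  then show ?thesis
    unfolding jump
  proof (rule Lim_transform_eventually)
    show "eventually (\<lambda>n. g (dyadic n (m n)) = dyadic_sum 0 f g n (n * 2 ^ n)) sequentially"
      using eventually_ge_at_top[of "nat \<lceil>T\<rceil>"] by eventually_elim (use sum_eq in auto)
  qed
qed

lemma left_limit_f:
  assumes "0 < t"
  shows "(f \<longlongrightarrow> left_limit f t) (at_left t)" "left_limit f t \<le> f t"
proof -
  obtain l where l: "(f \<longlongrightarrow> l) (at_left t)" using left_lim[OF assms] by blast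
  then have "left_limit f t = l" unfolding left_limit_def by (intro tendsto_Lim) auto
  with l show lim: "(f \<longlongrightarrow> left_limit f t) (at_left t)" by simp
  have "eventually (\<lambda>s. f s \<le> f t) (at_left t)"
    using eventually_at_left_real[OF assms] by eventually_elim (auto intro: f_mono)
  then show "left_limit f t \<le> f t" by (intro tendsto_upperbound[OF lim]) auto
qed

text \<open>The Riemann sums are Stieltjes integrals of step functions \<open>h n\<close> that
  converge pointwise to the integrand \<open>H\<close>. Fatou's lemma with the uniform bound on the
  sums makes \<open>H\<close> integrable over the whole half-line, and then a multiple of
  \<open>H\<close> itself dominates the step functions.\<close>

lemma tendsto_exp_integral:
  fixes c :: real
  assumes c: "1 < c"
  shows "(\<lambda>n. dyadic_sum (1 / c) f g n (n * 2 ^ n)) \<longlonglongrightarrow> exp_integral c f g"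
proof -
  define \<theta> where "\<theta> = 1 / c"
  have \<theta>: "0 < \<theta>" "\<theta> < 1" using c by (auto simp: \<theta>_def)
  define G where "G s = g (max 0 s)" for s
  define I where "I = interval_measure G"
  have G_mono: "G x \<le> G y" if "x \<le> y" for x y
    unfolding G_def using that by (intro g_mono) auto
  have G_cont: "continuous (at_right s) G" for s
  proof (cases "0 \<le> s")
    case True
    have "(g \<longlongrightarrow> g s) (at_right s)" using right_cont(2)[OF True] by (simp add: continuous_within)
    moreover have "eventually (\<lambda>x. g x = G x) (at_right s)"
      using True by (auto simp: eventually_at_filter G_def intro!: always_eventually)
    ultimately have "(G \<longlongrightarrow> g s) (at_right s)" by (rule Lim_transform_eventually)
    then show ?thesis using True by (simp add: continuous_within G_def)
  next
    case False
    then have "eventually (\<lambda>x. G x = G s) (at_right s)"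
      using eventually_at_right_real[of s 0] by (auto elim!: eventually_mono simp: G_def)
    then show ?thesis by (simp add: continuous_within tendsto_eventually)
  qed
  have sets_I [measurable_cong, simp]: "sets I = sets borel" and space_I [simp]: "space I = UNIV"
    by (auto simp: I_def)
  have emeasure_I: "emeasure I {x<..y} = ennreal (g y - g x)" if "0 \<le> x" "x \<le> y" for x y
    using emeasure_interval_measure_Ioc[OF that(2) G_mono G_cont] that by (simp add: I_def G_def)
  define k where "k n i = nat \<lfloor>f (dyadic n i)\<rfloor>" for n i
  have k: "real (k n i) = f (dyadic n i)" for n i
    unfolding k_def by (simp add: real_nat_floor_f)
  have \<theta>_k: "\<theta> ^ k n i = c powr (- f (dyadic n i))" for n i
    using c by (simp add: \<theta>_def power_one_over powr_minus powr_realpow divide_simps flip: k)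
  define h where "h n s = (\<Sum>i<n * 2 ^ n. \<theta> ^ k n i * indicator {dyadic n i<..dyadic n (Suc i)} s)"
    for n s
  define H where "H s = indicator {0<..} s * c powr (- left_limit f s)" for s
  have h_nonneg: "0 \<le> h n s" for n s
    unfolding h_def using \<theta> by (auto intro!: sum_nonneg)
  have h_meas [measurable]: "h n \<in> borel_measurable borel" for n
    unfolding h_def by measurable
  have h_nn: "(\<integral>\<^sup>+ s. ennreal (h n s) \<partial>I) = ennreal (dyadic_sum \<theta> f g n (n * 2 ^ n))" for n
  proof -
    have "(\<integral>\<^sup>+ s. ennreal (h n s) \<partial>I) =
        (\<integral>\<^sup>+ s. (\<Sum>i<n * 2 ^ n. ennreal (\<theta> ^ k n i) * indicator {dyadic n i<..dyadic n (Suc i)} s) \<partial>I)"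
      unfolding h_def using \<theta>
      by (intro nn_integral_cong) (auto simp: ennreal_mult ennreal_indicator simp flip: sum_ennreal)
    also have "\<dots> = (\<Sum>i<n * 2 ^ n. ennreal (\<theta> ^ k n i) * ennreal (g (dyadic n (Suc i)) - g (dyadic n i)))"
      by (subst nn_integral_sum) (auto simp: nn_integral_cmult_indicator emeasure_I)
    also have "\<dots> = ennreal (dyadic_sum \<theta> f g n (n * 2 ^ n))"
      unfolding dyadic_sum_def k_def[symmetric] using \<theta> incr_g
      by (auto simp flip: ennreal_mult simp: sum_ennreal)
    finally show ?thesis .
  qed
  have sum_nonneg: "0 \<le> dyadic_sum \<theta> f g n m" for n m
    unfolding dyadic_sum_def using \<theta> incr_g by (auto intro!: Groups_Big.sum_nonneg)
  have h_int: "integral\<^sup>L I (h n) = dyadic_sum \<theta> f g n (n * 2 ^ n)" for n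
    using h_nonneg h_nn sum_nonneg by (subst integral_eq_nn_integral) auto
  \<comment> \<open>Index of the cell containing s. Cells are open on the left, so the ceiling minus
    one is taken: the left endpoint is then strictly below s and the values there tend to the left
    limit, also for dyadic s.\<close>
  define e where "e n s = nat (\<lceil>s * 2 ^ n\<rceil> - 1)" for n and s :: real
  have e: "dyadic n (e n s) < s" "s \<le> dyadic n (Suc (e n s))" if "0 < s" for n s
  proof -
    have "0 < \<lceil>s * 2 ^ n\<rceil>" using that by simp
    then have "real (e n s) = of_int \<lceil>s * 2 ^ n\<rceil> - 1" unfolding e_def by simp
    moreover have "of_int \<lceil>s * 2 ^ n\<rceil> - 1 < s * 2 ^ n" "s * 2 ^ n \<le> of_int \<lceil>s * 2 ^ n\<rceil>" by linarith+
    ultimately show "dyadic n (e n s) < s" "s \<le> dyadic n (Suc (e n s))"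
      unfolding dyadic_def by (auto simp: field_simps)
  qed
  have h_eq: "h n s = (if s \<le> real n then c powr (- f (dyadic n (e n s))) else 0)" if "0 < s" for n s
  proof -
    have iff: "s \<in> {dyadic n i<..dyadic n (Suc i)} \<longleftrightarrow> i = e n s" for i
    proof
      assume "s \<in> {dyadic n i<..dyadic n (Suc i)}"
      then have "dyadic n i < dyadic n (Suc (e n s))" "dyadic n (e n s) < dyadic n (Suc i)"
        using e[OF that, of n] by (auto simp del: dyadic_less_iff)
      then show "i = e n s" by simp
    qed (use e[OF that] in auto)
    have "h n s = (\<Sum>i<n * 2 ^ n. if i = e n s then \<theta> ^ k n i else 0)"
      unfolding h_def by (intro sum.cong refl) (auto simp: indicator_def iff simp del: greaterThanAtMost_iff)
    also have "\<dots> = (if e n s < n * 2 ^ n then \<theta> ^ k n (e n s) else 0)"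
      by simp
    also have "e n s < n * 2 ^ n \<longleftrightarrow> s \<le> real n"
      using e[OF that, of n] dyadic_le_iff[of n "Suc (e n s)" "n * 2 ^ n"]
        dyadic_le_iff[of n "n * 2 ^ n" "e n s"] unfolding dyadic_end by auto
    finally show ?thesis by (simp add: \<theta>_k)
  qed
  have h_neg: "h n s = 0" if "s \<le> 0" for n s
  proof -
    have "\<not> dyadic n i < s" for i using that dyadic_nonneg[of n i] by linarith
    then show ?thesis unfolding h_def by (intro sum.neutral) auto
  qed
  have h_lim: "(\<lambda>n. h n s) \<longlonglongrightarrow> H s" for s
  proof (cases "0 < s")
    case True
    have "(\<lambda>n. dyadic n (e n s)) \<longlonglongrightarrow> s"
    proof (rule tendsto_sandwich[OF _ _ _ tendsto_const])
      show "(\<lambda>n. s - 1 / 2 ^ n) \<longlonglongrightarrow> s"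
        using tendsto_diff[OF tendsto_const LIMSEQ_power_zero[of "1 / 2 :: real"], of s]
        by (simp add: power_one_over)
      show "eventually (\<lambda>n. s - 1 / 2 ^ n \<le> dyadic n (e n s)) sequentially"
        using e(2)[OF True] by (auto simp: dyadic_Suc diff_le_eq)
    qed (use e(1)[OF True] in \<open>auto intro!: always_eventually less_imp_le\<close>)
    then have "filterlim (\<lambda>n. dyadic n (e n s)) (at_left s) sequentially"
      unfolding filterlim_at using e(1)[OF True] by (auto simp: less_imp_neq intro!: always_eventually)
    from filterlim_compose[OF left_limit_f(1)[OF True] this]
    have "(\<lambda>n. c powr (- f (dyadic n (e n s)))) \<longlonglongrightarrow> c powr (- left_limit f s)"
      using c by (intro tendsto_intros) auto
    then have "(\<lambda>n. c powr (- f (dyadic n (e n s)))) \<longlonglongrightarrow> H s" using True by (simp add: H_def)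
    then show ?thesis
    proof (rule Lim_transform_eventually)
      show "eventually (\<lambda>n. c powr (- f (dyadic n (e n s))) = h n s) sequentially"
        using eventually_ge_at_top[of "nat \<lceil>s\<rceil>"] by eventually_elim (use h_eq[OF True] in auto)
    qed
  qed (use h_neg in \<open>simp add: H_def\<close>)
  have H_meas [measurable]: "H \<in> borel_measurable borel"
    by (rule borel_measurable_LIMSEQ_real[OF h_lim]) (rule h_meas)
  have H_nonneg: "0 \<le> H s" for s by (simp add: H_def)
  obtain n0 where n0: "\<And>n. n0 \<le> n \<Longrightarrow> \<forall>i<n * 2 ^ n. f (dyadic n (Suc i)) - f (dyadic n i) \<le> 1"
    using small_incr unfolding eventually_sequentially by blast
  have "(\<integral>\<^sup>+ s. ennreal (H s) \<partial>I) = (\<integral>\<^sup>+ s. liminf (\<lambda>n. ennreal (h n s)) \<partial>I)"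
    using h_lim by (intro nn_integral_cong lim_imp_Liminf[symmetric] tendsto_ennrealI) auto
  also have "\<dots> \<le> liminf (\<lambda>n. \<integral>\<^sup>+ s. ennreal (h n s) \<partial>I)"
    by (rule nn_integral_liminf) measurable
  also have "\<dots> \<le> liminf (\<lambda>n. ennreal (a / (1 - \<theta>)))"
    using eventually_ge_at_top[of n0]
    by (intro Liminf_mono, eventually_elim)
      (use n0 dyadic_sum_bounds(2)[of \<theta>] \<theta> in \<open>auto simp: h_nn intro!: ennreal_leI\<close>)
  also have "\<dots> < \<infinity>" by (simp add: Liminf_const)
  finally have H_int: "integrable I H"
    using H_nonneg by (intro integrableI_nonneg) auto
  \<comment> \<open>At most one step occurs in the cell of s, so \<open>f\<close> at its left end is
    at least the left limit at s minus 1. That single possible step costs the factor c.\<close>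
  have h_le: "h n s \<le> c * H s" if "n0 \<le> n" for n s
  proof (cases "0 < s \<and> s \<le> real n")
    case True
    then have "e n s < n * 2 ^ n"
      using e(1)[of s n] dyadic_le_iff[of n "n * 2 ^ n" "e n s"] unfolding dyadic_end by auto
    then have "f (dyadic n (Suc (e n s))) \<le> 1 + f (dyadic n (e n s))" using n0[OF that] by force
    moreover have "left_limit f s \<le> f (dyadic n (Suc (e n s)))"
      using left_limit_f(2)[of s] f_mono[of s "dyadic n (Suc (e n s))"] e(2)[of s n] True by auto
    ultimately have "c powr (- f (dyadic n (e n s))) \<le> c powr (1 + (- left_limit f s))"
      using c by (intro powr_mono) auto
    also have "\<dots> = c * c powr (- left_limit f s)" using c by (subst powr_add) auto
    finally show ?thesis using True by (simp add: h_eq H_def)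
  next
    case False
    then show ?thesis using h_neg[of s n] h_eq[of s n] H_nonneg[of s] c by (cases "0 < s") auto
  qed
  \<comment> \<open>The shift by \<open>n0\<close> discards the levels at which a cell may still
    contain several steps and the domination can fail.\<close>
  have "(\<lambda>n. integral\<^sup>L I (h (n + n0))) \<longlonglongrightarrow> integral\<^sup>L I H"
    using LIMSEQ_ignore_initial_segment[OF h_lim] h_le H_int h_nonneg
    by (intro integral_dominated_convergence[where w = "\<lambda>s. c * H s"]) auto
  then have lim: "(\<lambda>n. dyadic_sum \<theta> f g n (n * 2 ^ n)) \<longlonglongrightarrow> integral\<^sup>L I H"
    unfolding h_int by (rule LIMSEQ_offset)
  have upto: "exp_integral_upto c f g t = (LINT s|I. indicator {..t} s * H s)" for t
    unfolding exp_integral_upto_def I_def G_def set_lebesgue_integral_def H_def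
    by (intro Bochner_Integration.integral_cong) (auto simp: indicator_def)
  have "((\<lambda>t. LINT s|I. indicator {..t} s * H s) \<longlongrightarrow> integral\<^sup>L I H) at_top"
  proof (rule integral_dominated_convergence_at_top[where w = H])
    show "AE s in I. ((\<lambda>t. indicator {..t} s * H s) \<longlongrightarrow> H s) at_top"
    proof (rule AE_I2)
      fix s
      have "eventually (\<lambda>t. indicator {..t} s * H s = H s) at_top"
        using eventually_ge_at_top[of s] by eventually_elim simp
      then show "((\<lambda>t. indicator {..t} s * H s) \<longlongrightarrow> H s) at_top" by (rule tendsto_eventually)
    qed
  qed (use H_int H_nonneg in \<open>auto simp: indicator_def\<close>)
  then have "exp_integral c f g = integral\<^sup>L I H"
    unfolding exp_integral_def upto by (intro tendsto_Lim) auto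
  with lim show ?thesis by (simp add: \<theta>_def)
qed

end

section \<open>The compound Poisson process\<close>

lemma fst_meas [measurable]: "fst \<in> borel_measurable (borel :: (real \<times> real) measure)"
  and snd_meas [measurable]: "snd \<in> borel_measurable (borel :: (real \<times> real) measure)"
  by (simp_all flip: borel_prod)

lemma borel_Nats [measurable]: "(\<nat> :: real set) \<in> sets borel"
  unfolding Nats_def by (rule sets.countable) auto

text \<open>An argument of Borel-Cantelli type: the series of the \<open>Z n\<close> has finite
  expectation, so it converges almost surely and its terms tend to 0.\<close>

lemma AE_tendsto_zero_of_summable_expectation:
  fixes Z :: "nat \<Rightarrow> 'a \<Rightarrow> real"
  assumes int: "\<And>n. integrable M (Z n)"
    and nonneg: "\<And>n. AE \<omega> in M. 0 \<le> Z n \<omega>"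
    and sum: "summable (\<lambda>n. integral\<^sup>L M (Z n))"
  shows "AE \<omega> in M. (\<lambda>n. Z n \<omega>) \<longlonglongrightarrow> 0"
proof -
  have [measurable]: "Z n \<in> borel_measurable M" for n using int by auto
  have "(\<integral>\<^sup>+ \<omega>. (\<Sum>n. ennreal (Z n \<omega>)) \<partial>M) = (\<Sum>n. \<integral>\<^sup>+ \<omega>. ennreal (Z n \<omega>) \<partial>M)"
    by (rule nn_integral_suminf) measurable
  also have "\<dots> = (\<Sum>n. ennreal (integral\<^sup>L M (Z n)))"
    using int nonneg by (intro suminf_cong nn_integral_eq_integral)
  also have "\<dots> = ennreal (\<Sum>n. integral\<^sup>L M (Z n))"
    using nonneg sum by (intro suminf_ennreal_eq) (auto intro!: integral_nonneg_AE summable_sums)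
  finally have "(\<integral>\<^sup>+ \<omega>. (\<Sum>n. ennreal (Z n \<omega>)) \<partial>M) \<noteq> \<infinity>" by simp
  then have "AE \<omega> in M. (\<Sum>n. ennreal (Z n \<omega>)) \<noteq> \<infinity>"
    by (intro nn_integral_PInf_AE) auto
  moreover have "AE \<omega> in M. \<forall>n. 0 \<le> Z n \<omega>" using nonneg by (simp add: AE_all_countable)
  ultimately show ?thesis
    by eventually_elim (auto intro!: summable_LIMSEQ_zero summable_suminf_not_top)
qed

section \<open>Poisson laws: moments, characteristic function and recognition by it\<close>

lemma poisson_sums:
  fixes m :: real
  shows "(\<lambda>n. m ^ n / fact n * exp (- m) * real n) sums m" (is "?A sums _")
    and "(\<lambda>n. m ^ n / fact n * exp (- m) * (real n * (real n - 1))) sums m\<^sup>2" (is "?B sums _")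
    and "(\<lambda>n. m ^ n / fact n * exp (- m) * \<theta> ^ n) sums exp (- (m * (1 - \<theta>)))" (is "?C sums _")
proof -
  have e: "(\<lambda>n. m ^ n / fact n) sums exp m" for m :: real
    using exp_converges[of m] by (simp add: divide_inverse mult.commute)
  have "(\<lambda>n. m * exp (- m) * (m ^ n / fact n)) sums (m * exp (- m) * exp m)"
    by (intro sums_mult e)
  moreover have "m * exp (- m) * exp m = m" by (simp add: mult.assoc flip: exp_add)
  ultimately have "(\<lambda>n. m * exp (- m) * (m ^ n / fact n)) sums m" by simp
  moreover have "(\<lambda>n. m * exp (- m) * (m ^ n / fact n)) = (\<lambda>n. ?A (Suc n))"
    by (rule ext) (simp add: field_simps del: of_nat_Suc)
  ultimately have A: "(\<lambda>n. ?A (Suc n)) sums m" by simp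
  then show "?A sums m" using sums_Suc[of ?A m] by simp
  have "(\<lambda>n. m * (m ^ n / fact n * exp (- m) * real n)) sums (m * m)"
    using sums_Suc[of ?A m] A by (intro sums_mult) simp
  moreover have "(\<lambda>n. m * (m ^ n / fact n * exp (- m) * real n)) = (\<lambda>n. ?B (Suc n))"
  proof
    fix n
    have eq: "real (Suc n) - 1 = real n" by simp
    show "m * (m ^ n / fact n * exp (- m) * real n) = ?B (Suc n)"
      unfolding eq by (simp add: field_simps del: of_nat_Suc)
  qed
  ultimately show "?B sums m\<^sup>2" using sums_Suc[of ?B "m\<^sup>2"] by (simp add: power2_eq_square)
  have "(\<lambda>n. exp (- m) * ((m * \<theta>) ^ n / fact n)) sums (exp (- m) * exp (m * \<theta>))"
    by (intro sums_mult e)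
  then show "?C sums exp (- (m * (1 - \<theta>)))"
    by (simp add: power_mult_distrib algebra_simps flip: exp_add)
qed

lemma char_poisson:
  assumes "0 < m"
  shows "char (distr (measure_pmf (poisson_pmf m)) borel real) z = exp (of_real m * (iexp z - 1))"
proof -
  have "char (distr (measure_pmf (poisson_pmf m)) borel real) z =
      (CLINT n|measure_pmf (poisson_pmf m). iexp (z * real n))"
    unfolding char_def by (subst integral_distr) auto
  also have "\<dots> = (CLINT n|count_space UNIV. pmf (poisson_pmf m) n *\<^sub>R iexp (z * real n))"
    by (simp add: measure_pmf_eq_density integral_density)
  also have "(\<lambda>n. pmf (poisson_pmf m) n *\<^sub>R iexp (z * real n)) sums \<dots>"
  proof (rule sums_integral_count_space_nat)
    have "integrable (count_space UNIV) (pmf (poisson_pmf m))" by (rule integrable_pmf)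
    then show "integrable (count_space UNIV) (\<lambda>n. pmf (poisson_pmf m) n *\<^sub>R iexp (z * real n))"
      by (rule Bochner_Integration.integrable_bound) auto
  qed
  moreover have "(\<lambda>n. pmf (poisson_pmf m) n *\<^sub>R iexp (z * real n)) sums exp (of_real m * (iexp z - 1))"
  proof -
    have "(\<lambda>n. exp (- of_real m) * ((of_real m * iexp z) ^ n /\<^sub>R fact n)) sums (exp (- of_real m) * exp (of_real m * iexp z))"
      by (intro sums_mult exp_converges)
    moreover have "pmf (poisson_pmf m) n *\<^sub>R iexp (z * real n) = exp (- of_real m) * ((of_real m * iexp z) ^ n /\<^sub>R fact n)" for n
      using assms
      by (simp add: power_mult_distrib scaleR_conv_of_real exp_of_nat_mult[symmetric] divide_inverse mult_ac exp_of_real[symmetric])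
    ultimately show ?thesis by (simp add: algebra_simps flip: exp_add)
  qed
  ultimately show ?thesis by (metis sums_unique2)
qed

context prob_space
begin

lemma poisson_distr_of_char:
  fixes Z :: "'a \<Rightarrow> real"
  assumes [measurable]: "Z \<in> borel_measurable M" and m: "0 < m"
    and char: "\<And>z. (CLINT \<omega>|M. iexp (z * Z \<omega>)) = exp (of_real m * (iexp z - 1))"
  shows "distr M borel Z = distr (measure_pmf (poisson_pmf m)) borel real"
proof (rule Levy_uniqueness)
  show "real_distribution (distr M borel Z)" by (rule real_distribution_distr) simp
  show "real_distribution (distr (measure_pmf (poisson_pmf m)) borel real)"
    by (rule prob_space.real_distribution_distr[OF measure_pmf.prob_space_axioms]) simp
  show "char (distr M borel Z) = char (distr (measure_pmf (poisson_pmf m)) borel real)"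
    by (rule ext) (simp only: char_poisson[OF m] flip: char, simp add: char_def integral_distr)
qed

lemma poisson_Nats:
  assumes [measurable]: "Z \<in> borel_measurable M"
    and "distr M borel Z = distr (measure_pmf (poisson_pmf m)) borel real"
  shows "AE \<omega> in M. Z \<omega> \<in> \<nat>"
proof -
  have "AE x in distr M borel Z. x \<in> \<nat>"
    unfolding assms(2) by (subst AE_distr_iff) auto
  then show ?thesis by (subst (asm) AE_distr_iff) auto
qed

text \<open>Nonnegativity of \<phi> is asked on the naturals only, where \<open>Z\<close> lives
  almost surely. This admits x (x - 1), which is negative on (0, 1).\<close>

lemma poisson_expectation:
  assumes [measurable]: "Z \<in> borel_measurable M" "\<phi> \<in> borel_measurable borel" and m: "0 < m"
    and distr: "distr M borel Z = distr (measure_pmf (poisson_pmf m)) borel real"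
    and nonneg: "\<And>n. 0 \<le> \<phi> (real n)"
    and sums: "(\<lambda>n. m ^ n / fact n * exp (- m) * \<phi> (real n)) sums S"
  shows "has_bochner_integral M (\<lambda>\<omega>. \<phi> (Z \<omega>)) S"
proof (rule has_bochner_integral_nn_integral)
  show "AE \<omega> in M. 0 \<le> \<phi> (Z \<omega>)"
    using poisson_Nats[OF assms(1) distr] by eventually_elim (auto simp: nonneg elim!: Nats_cases)
  show "0 \<le> S"
    using sums_le[OF _ sums_zero sums] nonneg m by simp
  have "(\<integral>\<^sup>+ \<omega>. ennreal (\<phi> (Z \<omega>)) \<partial>M) = (\<integral>\<^sup>+ x. ennreal (\<phi> x) \<partial>distr M borel Z)"
    by (simp add: nn_integral_distr)
  also have "\<dots> = (\<integral>\<^sup>+ n. ennreal (\<phi> (real n)) \<partial>measure_pmf (poisson_pmf m))"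
    unfolding distr by (simp add: nn_integral_distr)
  also have "\<dots> = (\<Sum>n. ennreal (m ^ n / fact n * exp (- m) * \<phi> (real n)))"
    using m nonneg by (simp add: nn_integral_measure_pmf nn_integral_count_space_nat flip: ennreal_mult)
  also have "\<dots> = ennreal S"
    using m nonneg by (intro suminf_ennreal_eq sums) auto
  finally show "(\<integral>\<^sup>+ \<omega>. ennreal (\<phi> (Z \<omega>)) \<partial>M) = ennreal S" .
qed simp

text \<open>Fubini for the product law of an independent pair: the inner integral freezes
  \<open>A\<close> and averages over an independent copy of \<open>B\<close>. It serves as
  conditioning on the past.\<close>

lemma indep_var_integral:
  fixes G :: "'b \<times> 'b \<Rightarrow> 'd::{banach, second_countable_topology}"
  assumes "indep_var S A T B" and G [measurable]: "G \<in> borel_measurable (S \<Otimes>\<^sub>M T)"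
    and bound: "\<And>x. norm (G x) \<le> C"
  shows "(LINT \<omega>|M. G (A \<omega>, B \<omega>)) = (LINT \<omega>|M. (LINT \<omega>'|M. G (A \<omega>, B \<omega>')))"
proof -
  have [measurable]: "random_variable S A" "random_variable T B"
    and eq: "distr M S A \<Otimes>\<^sub>M distr M T B = distr M (S \<Otimes>\<^sub>M T) (\<lambda>\<omega>. (A \<omega>, B \<omega>))"
    using assms(1) unfolding indep_var_distribution_eq by auto
  interpret SA: prob_space "distr M S A" by (rule prob_space_distr) simp
  interpret TB: prob_space "distr M T B" by (rule prob_space_distr) simp
  interpret P: pair_prob_space "distr M S A" "distr M T B" ..
  have G': "G \<in> borel_measurable (distr M S A \<Otimes>\<^sub>M distr M T B)"
    by (simp cong: measurable_cong_sets sets_pair_measure_cong)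
  have "(LINT \<omega>|M. G (A \<omega>, B \<omega>)) = integral\<^sup>L (distr M S A \<Otimes>\<^sub>M distr M T B) G"
    unfolding eq by (subst integral_distr) auto
  also have "\<dots> = (LINT x|distr M S A. (LINT y|distr M T B. G (x, y)))"
    using bound G' by (intro P.integral_fst'[symmetric] P.P.integrable_const_bound[where B = C]) auto
  also have "\<dots> = (LINT \<omega>|M. (LINT y|distr M T B. G (A \<omega>, y)))"
    by (subst integral_distr) auto
  also have "\<dots> = (LINT \<omega>|M. (LINT \<omega>'|M. G (A \<omega>, B \<omega>')))"
    by (intro Bochner_Integration.integral_cong refl, subst integral_distr) auto
  finally show ?thesis .
qed

end

lemma borel_measurable_completion_AE_eq:
  fixes Y Y' :: "'a \<Rightarrow> real"
  assumes Y': "Y' \<in> borel_measurable M" and eq: "AE \<omega> in M. Y \<omega> = Y' \<omega>"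
  shows "Y \<in> borel_measurable (completion M)"
proof (rule measurableI)
  fix A :: "real set" assume A: "A \<in> sets borel"
  have ae: "AE \<omega> in completion M. \<omega> \<in> Y' -` A \<inter> space M \<longleftrightarrow> \<omega> \<in> Y -` A \<inter> space (completion M)"
    using AE_completion[OF eq] by eventually_elim auto
  show "Y -` A \<inter> space (completion M) \<in> sets (completion M)"
    by (rule completion.in_sets_AE[OF ae]) (use measurable_sets[OF Y' A] in auto)
qed simp

text \<open>The path functionals are defined by limits and infima over uncountable sets, so they are
  replaced by a measurable variable that agrees with them almost everywhere; the completion does not
  see the difference.\<close>

lemma law_eq_distr:
  assumes "Y' \<in> borel_measurable M" "AE \<omega> in M. Y \<omega> = Y' \<omega>"
  shows "law M Y = distr M borel Y'"
proof -
  have "law M Y = distr (completion M) borel Y'"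
    unfolding law_def
    using AE_completion[OF assms(2)] borel_measurable_completion_AE_eq[OF assms] measurable_completion[OF assms(1)]
    by (intro distr_cong_AE) auto
  then show ?thesis using distr_completion[OF assms(1)] by simp
qed

lemma norm_integral_le_integral:
  fixes f :: "'a \<Rightarrow> 'b::{banach, second_countable_topology}"
  assumes "integrable M f" "integrable M g" "\<And>x. x \<in> space M \<Longrightarrow> norm (f x) \<le> g x"
  shows "norm (integral\<^sup>L M f) \<le> integral\<^sup>L M g"
  using assms by (intro order_trans[OF integral_norm_bound integral_mono]) auto

lemma measure_support_subset_closed:
  assumes "closed S" "emeasure \<sigma> (- S) = 0"
  shows "measure_support \<sigma> \<subseteq> S"
proof
  fix x assume x: "x \<in> measure_support \<sigma>"
  show "x \<in> S"
  proof (rule ccontr)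
    assume "x \<notin> S"
    then have "emeasure \<sigma> (- S) > 0" using x assms(1) unfolding measure_support_def by auto
    with assms(2) show False by simp
  qed
qed

text \<open>For \<open>n = i + j \<ge> 2\<close> the left side is at most \<open>2 + 2 n \<le> 3 n (n - 1)\<close>, while for
  \<open>n \<le> 1\<close> it vanishes: the linear interpolation is exact there.\<close>

lemma first_order_expansion:
  fixes e A B :: complex and F :: "nat \<Rightarrow> complex" and i j :: nat
  assumes norm: "norm e = 1" "\<And>n. norm (F n) \<le> 1"
  shows "norm (e ^ j * F (i + j) - (F 0 + (F 1 - F 0) * of_nat i + (e * F 1 - F 0) * of_nat j))
    \<le> 3 * (real (i + j) * (real (i + j) - 1))"
proof -
  consider "i = 0" "j = 0" | "i = 1" "j = 0" | "i = 0" "j = 1" | "2 \<le> i + j" by linarith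
  then show ?thesis
  proof cases
    case 4
    have "norm (F 1 - F 0) \<le> 2" "norm (e * F 1 - F 0) \<le> 2"
      using norm_triangle_ineq4[of "F 1" "F 0"] norm_triangle_ineq4[of "e * F 1" "F 0"] norm(2)[of 0] norm(2)[of 1]
      by (auto simp: norm_mult norm(1))
    then have "norm ((F 1 - F 0) * of_nat i) \<le> 2 * real i" "norm ((e * F 1 - F 0) * of_nat j) \<le> 2 * real j"
      by (auto simp: norm_mult intro!: mult_right_mono)
    moreover have "norm (e ^ j * F (i + j)) \<le> 1" using norm by (simp add: norm_mult norm_power)
    ultimately have "norm (e ^ j * F (i + j) - (F 0 + (F 1 - F 0) * of_nat i + (e * F 1 - F 0) * of_nat j))
        \<le> 1 + (1 + 2 * real i + 2 * real j)"
      using norm(2)[of 0]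
      by (intro order_trans[OF norm_triangle_ineq4] add_mono order_trans[OF norm_triangle_ineq]) auto
    also have "\<dots> \<le> 3 * real (i + j)" using 4 by simp
    also have "\<dots> \<le> 3 * (real (i + j) * (real (i + j) - 1))"
    proof -
      have "real (i + j) * 1 \<le> real (i + j) * (real (i + j) - 1)" using 4 by (intro mult_left_mono) auto
      then show ?thesis by simp
    qed
    finally show ?thesis .
  qed (use norm in auto)
qed

section \<open>The process with v = 0: Poisson counts and almost sure properties of the
  paths\<close>

locale NL_process_q0 = NL_process M N L c k u v w
  for M :: "'a measure" and N L :: "real \<Rightarrow> 'a \<Rightarrow> real" and c :: real and k :: int and u v w :: real +
  assumes v_0: "v = 0" and u_pos: "0 < u" and w_pos: "0 < w"
begin

definition a :: real where "a = c powi (- k)"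

lemma a_pos: "0 < a" using c_gt_1 by (simp add: a_def)

lemma N_meas [measurable]: "0 \<le> t \<Longrightarrow> N t \<in> borel_measurable M"
  and L_meas [measurable]: "0 \<le> t \<Longrightarrow> L t \<in> borel_measurable M"
  using random_variable[of t] by (auto simp: borel_prod[symmetric] dest: measurable_compose[OF _ measurable_fst] measurable_compose[OF _ measurable_snd])

lemma jump_integral:
  "(CLINT x|jump_measure c k u v w. iexp (z1 * fst x + z2 * snd x) - 1) =
    u * (iexp z1 - 1) + w * (iexp (z1 + z2 * a) - 1)"
proof -
  let ?S = "{(1, 0), (0, 1), (1, a)} :: (real \<times> real) set"
  let ?f = "\<lambda>x. if x = (1, 0) then u else if x = (0, 1) then v else w"
  let ?g = "\<lambda>x. iexp (z1 * fst x + z2 * snd x) - 1"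
  have g: "?g \<in> borel_measurable (borel :: (real \<times> real) measure)"
    by (intro borel_measurable_continuous_onI continuous_intros)
  have "(CLINT x|jump_measure c k u v w. ?g x) = (CLINT x|point_measure ?S ?f. ?g x)"
    unfolding jump_measure_def a_def using g
    by (subst integral_distr) (auto intro!: measurableI simp: space_point_measure sets_point_measure)
  also have "\<dots> = (\<Sum>x\<in>?S. ?f x *\<^sub>R ?g x)"
    using masses_nonneg by (intro lebesgue_integral_point_measure_finite) auto
  also have "\<dots> = u * (iexp z1 - 1) + w * (iexp (z1 + z2 * a) - 1)"
    using a_pos v_0 by (simp add: scaleR_conv_of_real)
  finally show ?thesis .
qed

lemma joint_char:
  assumes "0 \<le> t"
  shows "(CLINT \<omega>|M. iexp (z1 * N t \<omega> + z2 * L t \<omega>)) =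
    exp (t * (u * (iexp z1 - 1) + w * (iexp (z1 + z2 * a) - 1)))"
  using characteristic_function[OF assms, of z1 z2] unfolding jump_integral .

text \<open>N - L/a counts the jumps (1, 0) and L/a the jumps (1, a). Each law is read off the joint
  characteristic function along one line of arguments: (z, -z/a), (0, z/a) and (z, 0).\<close>

lemma poisson_marginals:
  assumes t: "0 < t"
  shows "distr M borel (\<lambda>\<omega>. N t \<omega> - L t \<omega> / a) = distr (measure_pmf (poisson_pmf (u * t))) borel real"
    and "distr M borel (\<lambda>\<omega>. L t \<omega> / a) = distr (measure_pmf (poisson_pmf (w * t))) borel real"
    and "distr M borel (N t) = distr (measure_pmf (poisson_pmf ((u + w) * t))) borel real"
proof -
  note [measurable] = N_meas[of t] L_meas[of t]
  note pos = u_pos w_pos a_pos t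
  note j = joint_char[of t]
  show "distr M borel (\<lambda>\<omega>. N t \<omega> - L t \<omega> / a) = distr (measure_pmf (poisson_pmf (u * t))) borel real"
    using pos j[of z "- (z / a)" for z]
    by (intro poisson_distr_of_char) (auto simp: algebra_simps)
  show "distr M borel (\<lambda>\<omega>. L t \<omega> / a) = distr (measure_pmf (poisson_pmf (w * t))) borel real"
    using pos j[of 0 "z / a" for z]
    by (intro poisson_distr_of_char) (auto simp: algebra_simps)
  show "distr M borel (N t) = distr (measure_pmf (poisson_pmf ((u + w) * t))) borel real"
    using pos j[of z 0 for z]
    by (intro poisson_distr_of_char) (auto simp: algebra_simps intro!: add_pos_pos)
qed

definition X :: "real \<Rightarrow> 'a \<Rightarrow> real \<times> real" where
  "X t \<omega> = (N t \<omega>, L t \<omega>)"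

lemma X_meas: "0 \<le> t \<Longrightarrow> X t \<in> borel_measurable M"
  unfolding X_def using random_variable[of t] .

lemma X_diff_distr:
  assumes "0 \<le> s" "0 \<le> t"
  shows "distr M borel (\<lambda>\<omega>. X (s + t) \<omega> - X s \<omega>) = distr M borel (X t)"
  using stationary_increments[OF assms] unfolding X_def .

lemma X_diff_integral:
  fixes \<phi> :: "real \<times> real \<Rightarrow> 'b::{banach, second_countable_topology}"
  assumes "0 \<le> s" "0 \<le> t" and \<phi>: "\<phi> \<in> borel_measurable borel"
  shows "(LINT \<omega>|M. \<phi> (X (s + t) \<omega> - X s \<omega>)) = (LINT \<omega>|M. \<phi> (X t \<omega>))"
    and "integrable M (\<lambda>\<omega>. \<phi> (X (s + t) \<omega> - X s \<omega>)) \<longleftrightarrow> integrable M (\<lambda>\<omega>. \<phi> (X t \<omega>))"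
proof -
  have m: "(\<lambda>\<omega>. X (s + t) \<omega> - X s \<omega>) \<in> borel_measurable M" "X t \<in> borel_measurable M"
    using assms(1,2) by (auto intro!: borel_measurable_diff X_meas)
  show "(LINT \<omega>|M. \<phi> (X (s + t) \<omega> - X s \<omega>)) = (LINT \<omega>|M. \<phi> (X t \<omega>))"
    using integral_distr[OF m(1) \<phi>] integral_distr[OF m(2) \<phi>] X_diff_distr[OF assms(1,2)] by simp
  show "integrable M (\<lambda>\<omega>. \<phi> (X (s + t) \<omega> - X s \<omega>)) \<longleftrightarrow> integrable M (\<lambda>\<omega>. \<phi> (X t \<omega>))"
    using integrable_distr_eq[OF m(1) \<phi>] integrable_distr_eq[OF m(2) \<phi>] X_diff_distr[OF assms(1,2)] by simp
qed

lemma X_Nats: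
  assumes t: "0 < t"
  shows "AE \<omega> in M. N t \<omega> - L t \<omega> / a \<in> \<nat> \<and> L t \<omega> / a \<in> \<nat>"
proof -
  note [measurable] = N_meas[of t] L_meas[of t]
  show ?thesis
    using poisson_Nats[OF _ poisson_marginals(1)[OF t]] poisson_Nats[OF _ poisson_marginals(2)[OF t]] t
    by auto
qed

text \<open>Stationarity transfers to increments what is known of X t. The bound on the increment of
  \<open>L\<close> expresses that the count N - L/a of jumps (1, 0) cannot be negative.\<close>

lemma X_diff_Nats:
  assumes "0 \<le> s" "0 < t"
  shows "AE \<omega> in M. N (s + t) \<omega> - N s \<omega> \<in> \<nat> \<and> 0 \<le> L (s + t) \<omega> - L s \<omega> \<and>
    L (s + t) \<omega> - L s \<omega> \<le> a * (N (s + t) \<omega> - N s \<omega>)"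
proof -
  let ?P = "\<lambda>x :: real \<times> real. fst x - snd x / a \<in> \<nat> \<and> snd x / a \<in> \<nat>"
  have P [measurable]: "Measurable.pred borel ?P" by measurable
  have m: "(\<lambda>\<omega>. X (s + t) \<omega> - X s \<omega>) \<in> borel_measurable M" "X t \<in> borel_measurable M"
    using assms by (auto intro!: borel_measurable_diff X_meas)
  have "AE x in distr M borel (X t). ?P x"
    using X_Nats[OF assms(2)] m(2) by (subst AE_distr_iff) (auto simp: X_def)
  then have "AE x in distr M borel (\<lambda>\<omega>. X (s + t) \<omega> - X s \<omega>). ?P x"
    using assms by (subst X_diff_distr) auto
  then have "AE \<omega> in M. ?P (X (s + t) \<omega> - X s \<omega>)"
    by (rule AE_distr_iff[OF m(1), THEN iffD1, rotated]) measurable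
  then show ?thesis
  proof eventually_elim
    case (elim \<omega>)
    define n l where "n = N (s + t) \<omega> - N s \<omega>" and "l = L (s + t) \<omega> - L s \<omega>"
    have *: "n - l / a \<in> \<nat>" "l / a \<in> \<nat>" using elim by (auto simp: X_def n_def l_def)
    then have "(n - l / a) + l / a \<in> \<nat>" by (rule Nats_add)
    moreover have "0 \<le> n - l / a" "0 \<le> l / a" using * by (auto elim: Nats_cases)
    ultimately show ?case
      unfolding n_def[symmetric] l_def[symmetric] using a_pos by (auto simp: field_simps zero_le_mult_iff)
  qed
qed

lemma X_moments:
  assumes t: "0 < t"
  shows "has_bochner_integral M (\<lambda>\<omega>. N t \<omega> - L t \<omega> / a) (u * t)"
    and "has_bochner_integral M (\<lambda>\<omega>. L t \<omega> / a) (w * t)"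
    and "has_bochner_integral M (\<lambda>\<omega>. N t \<omega> * (N t \<omega> - 1)) (((u + w) * t)\<^sup>2)"
    and "0 \<le> \<theta> \<Longrightarrow> has_bochner_integral M (\<lambda>\<omega>. \<theta> ^ nat \<lfloor>N t \<omega>\<rfloor>) (exp (- ((u + w) * t * (1 - \<theta>))))"
proof -
  note [measurable] = N_meas[of t] L_meas[of t]
  have pos: "0 \<le> t" "0 < u * t" "0 < w * t" "0 < (u + w) * t" using t u_pos w_pos by auto
  note N = poisson_marginals(3)[OF t]
  show "has_bochner_integral M (\<lambda>\<omega>. N t \<omega> - L t \<omega> / a) (u * t)"
    using pos poisson_sums(1)
    by (intro poisson_expectation[where \<phi> = "\<lambda>x. x", OF _ _ _ poisson_marginals(1)[OF t]]) auto
  show "has_bochner_integral M (\<lambda>\<omega>. L t \<omega> / a) (w * t)"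
    using pos poisson_sums(1)
    by (intro poisson_expectation[where \<phi> = "\<lambda>x. x", OF _ _ _ poisson_marginals(2)[OF t]]) auto
  have "0 \<le> real n * (real n - 1)" for n by (cases n) auto
  then show "has_bochner_integral M (\<lambda>\<omega>. N t \<omega> * (N t \<omega> - 1)) (((u + w) * t)\<^sup>2)"
    using pos poisson_sums(2)
    by (intro poisson_expectation[where \<phi> = "\<lambda>x. x * (x - 1)", OF _ _ _ N]) auto
  show "has_bochner_integral M (\<lambda>\<omega>. \<theta> ^ nat \<lfloor>N t \<omega>\<rfloor>) (exp (- ((u + w) * t * (1 - \<theta>))))" if "0 \<le> \<theta>"
    using pos poisson_sums(3) that
    by (intro poisson_expectation[where \<phi> = "\<lambda>x. \<theta> ^ nat \<lfloor>x\<rfloor>", OF _ _ _ N]) auto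
qed

text \<open>The Poisson generating function gives geometrically decaying expectations along integer
  times, hence summable ones. For \<theta> = 0 the conclusion says that \<open>N\<close> eventually
  becomes positive.\<close>

lemma AE_power_N_tendsto_0:
  fixes \<theta> :: real
  assumes \<theta>: "0 \<le> \<theta>" "\<theta> < 1"
  shows "AE \<omega> in M. (\<lambda>n. \<theta> ^ nat \<lfloor>N (real n) \<omega>\<rfloor>) \<longlonglongrightarrow> 0"
proof -
  have h: "has_bochner_integral M (\<lambda>\<omega>. \<theta> ^ nat \<lfloor>N (real (Suc n)) \<omega>\<rfloor>)
      (exp (- ((u + w) * real (Suc n) * (1 - \<theta>))))" for n
    by (rule X_moments(4)) (use \<theta> in auto)
  define e where "e = exp (- ((u + w) * (1 - \<theta>)))"
  have "0 < (u + w) * (1 - \<theta>)" using u_pos w_pos \<theta> by simp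
  then have e: "0 \<le> e" "e < 1" by (auto simp: e_def)
  have "AE \<omega> in M. (\<lambda>n. \<theta> ^ nat \<lfloor>N (real (Suc n)) \<omega>\<rfloor>) \<longlonglongrightarrow> 0"
  proof (rule AE_tendsto_zero_of_summable_expectation)
    have "expectation (\<lambda>\<omega>. \<theta> ^ nat \<lfloor>N (real (Suc n)) \<omega>\<rfloor>) = e ^ Suc n" for n
      using h[of n] unfolding has_bochner_integral_iff e_def exp_of_nat_mult[symmetric]
      by (simp add: algebra_simps)
    then show "summable (\<lambda>n. expectation (\<lambda>\<omega>. \<theta> ^ nat \<lfloor>N (real (Suc n)) \<omega>\<rfloor>))"
      using e by (simp only: summable_Suc_iff) (intro summable_geometric, simp)
  qed (use h \<theta> in \<open>auto simp: has_bochner_integral_iff\<close>)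
  then show ?thesis by eventually_elim (rule LIMSEQ_imp_Suc)
qed

text \<open>For a count D, the product D (D - 1) is 0 if D <= 1 and at least 2 otherwise. Summed
  over the n 2^n cells its expectation is (u + w)^2 n 2^-n, which is summable in n; so the sum is
  eventually below 1 and no cell has a count of two or more.\<close>

lemma AE_small_increments:
  "AE \<omega> in M. eventually (\<lambda>n. \<forall>i<n * 2 ^ n. N (dyadic n (Suc i)) \<omega> - N (dyadic n i) \<omega> \<le> 1) sequentially"
proof -
  define D where "D n i \<omega> = N (dyadic n i + 1 / 2 ^ n) \<omega> - N (dyadic n i) \<omega>" for n i \<omega>
  define Z where "Z n \<omega> = (\<Sum>i<n * 2 ^ n. D n i \<omega> * (D n i \<omega> - 1))" for n \<omega>
  have D: "integrable M (\<lambda>\<omega>. D n i \<omega> * (D n i \<omega> - 1))"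
    "expectation (\<lambda>\<omega>. D n i \<omega> * (D n i \<omega> - 1)) = ((u + w) / 2 ^ n)\<^sup>2" for n i
    using X_moments(3)[of "1 / 2 ^ n"]
      X_diff_integral[of "dyadic n i" "1 / 2 ^ n" "\<lambda>x. fst x * (fst x - 1)"]
    by (auto simp: D_def X_def has_bochner_integral_iff)
  have nats: "AE \<omega> in M. \<forall>n i. D n i \<omega> \<in> \<nat>"
    unfolding AE_all_countable D_def using X_diff_Nats[of "dyadic n i" "1 / 2 ^ n" for n i] by auto
  have dd: "0 \<le> x * (x - 1)" if "x \<in> \<nat>" for x :: real
    using that by (rule Nats_cases) (auto simp: zero_le_mult_iff)
  have "AE \<omega> in M. (\<lambda>n. Z n \<omega>) \<longlonglongrightarrow> 0"
  proof (rule AE_tendsto_zero_of_summable_expectation)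
    show "integrable M (Z n)" for n unfolding Z_def by (intro Bochner_Integration.integrable_sum D)
    show "AE \<omega> in M. 0 \<le> Z n \<omega>" for n
      using nats by eventually_elim (auto simp: Z_def intro!: sum_nonneg dd)
    have eq: "expectation (Z n) = (u + w)\<^sup>2 * (real n * (1 / 2) ^ n)" for n
      unfolding Z_def
      by (subst Bochner_Integration.integral_sum, rule D(1), simp only: D(2) sum_constant card_lessThan)
        (simp add: power2_eq_square field_simps)
    have "summable (\<lambda>n. real (Suc n) * (1 / 2) ^ n)"
      using geometric_deriv_sums[of "1 / 2 :: real"] by (auto simp: sums_iff)
    then have "summable (\<lambda>n. real n * (1 / 2) ^ n)"
      by (rule summable_comparison_test'[of _ 0]) (auto intro!: mult_right_mono)
    then show "summable (\<lambda>n. expectation (Z n))" unfolding eq by (rule summable_mult)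
  qed
  with nats show ?thesis
  proof eventually_elim
    case (elim \<omega>)
    have "eventually (\<lambda>n. Z n \<omega> < 1) sequentially" using elim(2) by (rule order_tendstoD) simp
    then show ?case
    proof eventually_elim
      case (elim n)
      show ?case
      proof (intro allI impI)
        fix i assume "i < n * 2 ^ n"
        then have "D n i \<omega> * (D n i \<omega> - 1) \<le> Z n \<omega>"
          unfolding Z_def using \<open>\<forall>n i. D n i \<omega> \<in> \<nat>\<close> by (intro member_le_sum) (auto intro!: dd)
        then have lt: "D n i \<omega> * (D n i \<omega> - 1) < 1" using elim by linarith
        have "D n i \<omega> \<in> \<nat>" using \<open>\<forall>n i. D n i \<omega> \<in> \<nat>\<close> by blast
        then obtain d where d: "D n i \<omega> = real d" by (rule Nats_cases)
        have "d \<le> 1"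
        proof (rule ccontr)
          assume "\<not> d \<le> 1"
          then have "2 * 1 \<le> real d * (real d - 1)" by (intro mult_mono) auto
          then show False using lt d by simp
        qed
        then show "N (dyadic n (Suc i)) \<omega> - N (dyadic n i) \<omega> \<le> 1"
          using d by (simp add: D_def dyadic_Suc)
      qed
    qed
  qed
qed

lemma AE_stepping_path: "AE \<omega> in M. stepping_path (\<lambda>t. N t \<omega>) (\<lambda>t. L t \<omega>) a"
proof -
  have "AE \<omega> in M. \<forall>n i. N (dyadic n (Suc i)) \<omega> - N (dyadic n i) \<omega> \<in> \<nat> \<and>
      0 \<le> L (dyadic n (Suc i)) \<omega> - L (dyadic n i) \<omega> \<and>
      L (dyadic n (Suc i)) \<omega> - L (dyadic n i) \<omega> \<le> a * (N (dyadic n (Suc i)) \<omega> - N (dyadic n i) \<omega>)"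
    unfolding AE_all_countable dyadic_Suc using X_diff_Nats[of "dyadic n i" "1 / 2 ^ n" for n i] by auto
  with start_zero cadlag_paths AE_small_increments show ?thesis
  proof eventually_elim
    case (elim \<omega>)
    show ?case
    proof
      show "0 \<le> a" using a_pos by simp
      show "N 0 \<omega> = 0" "L 0 \<omega> = 0" using elim(1) by (auto simp: zero_prod_def)
      fix t :: real
      show "continuous (at_right t) (\<lambda>t. N t \<omega>)" if "0 \<le> t"
        using elim(2) that continuous_fst[of "at_right t" "\<lambda>t. (N t \<omega>, L t \<omega>)"] by auto
      show "continuous (at_right t) (\<lambda>t. L t \<omega>)" if "0 \<le> t"
        using elim(2) that continuous_snd[of "at_right t" "\<lambda>t. (N t \<omega>, L t \<omega>)"] by auto
      show "\<exists>l. ((\<lambda>t. N t \<omega>) \<longlongrightarrow> l) (at_left t)" if "0 < t"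
      proof -
        obtain l where "((\<lambda>t. (N t \<omega>, L t \<omega>)) \<longlongrightarrow> l) (at_left t)" using elim(2) \<open>0 < t\<close> by blast
        from tendsto_fst[OF this] show ?thesis by auto
      qed
    qed (use elim in blast)+
  qed
qed

lemma stepping_sum_bounds:
  fixes \<theta> :: real
  assumes \<theta>: "0 \<le> \<theta>" "\<theta> < 1"
  shows "AE \<omega> in M. eventually (\<lambda>n.
      dyadic_sum \<theta> (\<lambda>t. N t \<omega>) (\<lambda>t. L t \<omega>) n (n * 2 ^ n) \<in> {0..a / (1 - \<theta>)}) sequentially"
  using AE_stepping_path
proof eventually_elim
  case (elim \<omega>)
  interpret stepping_path "\<lambda>t. N t \<omega>" "\<lambda>t. L t \<omega>" a by (rule elim)
  from small_incr show ?case
    by eventually_elim (use dyadic_sum_bounds \<theta> in auto)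
qed

section \<open>Identification of the law from a solution of the functional equation\<close>

context
  fixes \<theta> :: real and \<Phi> :: "real \<Rightarrow> complex"
  assumes \<theta>: "0 \<le> \<theta>" "\<theta> < 1"
    and \<Phi>_cont: "continuous_on UNIV \<Phi>" and \<Phi>_0: "\<Phi> 0 = 1"
    and \<Phi>_eq: "\<And>z. of_real (u + w) * \<Phi> z = (of_real u + of_real w * iexp (a * z)) * \<Phi> (\<theta> * z)"
begin

lemma \<Phi>_meas [measurable]: "\<Phi> \<in> borel_measurable borel"
  using \<Phi>_cont by (rule borel_measurable_continuous_onI)

lemma tendsto_\<Phi>:
  assumes "(f \<longlongrightarrow> 0) F"
  shows "((\<lambda>x. \<Phi> (f x)) \<longlongrightarrow> 1) F"
  using continuous_on_tendsto_compose[OF \<Phi>_cont assms] \<Phi>_0 by simp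

text \<open>The equation writes \<Phi>(z) as \<Phi>(\<theta>z) times a factor of modulus at most 1.
  Iterating contracts the argument to 0, where continuity gives the value 1.\<close>

lemma norm_\<Phi>: "norm (\<Phi> z) \<le> 1"
proof -
  have step: "norm (\<Phi> z) \<le> norm (\<Phi> (\<theta> * z))" for z
  proof -
    have "(u + w) * norm (\<Phi> z) = norm (of_real u + of_real w * iexp (a * z)) * norm (\<Phi> (\<theta> * z))"
      using arg_cong[OF \<Phi>_eq[of z], of norm] u_pos w_pos by (simp add: norm_mult flip: of_real_add)
    also have "\<dots> \<le> (u + w) * norm (\<Phi> (\<theta> * z))"
      using norm_triangle_ineq[of "of_real u" "of_real w * iexp (a * z)"] u_pos w_pos
      by (intro mult_right_mono) (auto simp: norm_mult)
    finally show ?thesis using u_pos w_pos by simp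
  qed
  have "norm (\<Phi> z) \<le> norm (\<Phi> (\<theta> ^ n * z))" for n
  proof (induction n)
    case (Suc n)
    then show ?case using step[of "\<theta> ^ n * z"] by (simp add: mult.assoc)
  qed simp
  moreover have "(\<lambda>n. norm (\<Phi> (\<theta> ^ n * z))) \<longlonglongrightarrow> norm (1::complex)"
    using \<theta> by (intro tendsto_norm tendsto_\<Phi> tendsto_mult_left_zero LIMSEQ_power_zero) auto
  ultimately show ?thesis
    by (intro LIMSEQ_le_const[of _ "1 :: real"]) auto
qed

text \<open>In the state y = z \<theta>^N an increment x of the process contributes the phase exp(iy
  snd x) and moves the state to y \<theta>^(fst x). This is the resulting factor that takes the
  place of \<Phi>(y).\<close>

definition step_val :: "real \<Rightarrow> real \<times> real \<Rightarrow> complex" where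
  "step_val y x = iexp (y * snd x) * \<Phi> (y * \<theta> ^ nat \<lfloor>fst x\<rfloor>)"

lemma step_val_meas [measurable]: "step_val y \<in> borel_measurable borel"
  unfolding step_val_def by measurable

lemma norm_step_val: "norm (step_val y x) \<le> 1"
  unfolding step_val_def using norm_\<Phi> by (simp add: norm_mult)

text \<open>\<open>R\<close> is the interpolation affine in the two jump counts, so its mean
  involves only first moments and equals \<Phi>(y) by the functional equation. It is exact for at
  most one jump; the event of several jumps is charged to E[N(N - 1)] = ((u + w) t)^2.\<close>

lemma expectation_step_val:
  assumes t: "0 < t"
  shows "norm ((LINT \<omega>|M. step_val y (X t \<omega>)) - \<Phi> y) \<le> 3 * ((u + w) * t)\<^sup>2"
proof -
  define U where "U \<omega> = N t \<omega> - L t \<omega> / a" for \<omega>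
  define W where "W \<omega> = L t \<omega> / a" for \<omega>
  define R where "R \<omega> = \<Phi> y + (\<Phi> (\<theta> * y) - \<Phi> y) * of_real (U \<omega>)
    + (iexp (a * y) * \<Phi> (\<theta> * y) - \<Phi> y) * of_real (W \<omega>)" for \<omega>
  note mom = X_moments(1-3)[OF t, folded U_def W_def, unfolded has_bochner_integral_iff]
  have R: "integrable M R" "integral\<^sup>L M R = \<Phi> y"
  proof -
    show "integrable M R" unfolding R_def using mom by auto
    have "integral\<^sup>L M R = \<Phi> y + (\<Phi> (\<theta> * y) - \<Phi> y) * of_real (u * t)
      + (iexp (a * y) * \<Phi> (\<theta> * y) - \<Phi> y) * of_real (w * t)"
      unfolding R_def using mom by (simp add: prob_space)
    also have "\<dots> = \<Phi> y + of_real t * ((of_real u + of_real w * iexp (a * y)) * \<Phi> (\<theta> * y) - of_real (u + w) * \<Phi> y)"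
      by (simp add: algebra_simps)
    \<comment> \<open>The functional equation enters here: it makes the coefficient of t
      vanish.\<close>
    also have "\<dots> = \<Phi> y" by (simp only: \<Phi>_eq) simp
    finally show "integral\<^sup>L M R = \<Phi> y" .
  qed
  have "(\<lambda>\<omega>. step_val y (X t \<omega>)) \<in> borel_measurable M"
    using measurable_compose[OF X_meas step_val_meas] t by simp
  then have HX: "integrable M (\<lambda>\<omega>. step_val y (X t \<omega>))"
    using norm_step_val by (intro integrable_const_bound[where B = 1]) auto
  have "norm ((LINT \<omega>|M. step_val y (X t \<omega>)) - \<Phi> y) = norm (LINT \<omega>|M. step_val y (X t \<omega>) - R \<omega>)"
    using HX R by simp
  also have "\<dots> \<le> (LINT \<omega>|M. norm (step_val y (X t \<omega>) - R \<omega>))" by simp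
  also have "\<dots> \<le> (LINT \<omega>|M. 3 * (N t \<omega> * (N t \<omega> - 1)))"
  proof (rule integral_mono_AE)
    show "AE \<omega> in M. norm (step_val y (X t \<omega>) - R \<omega>) \<le> 3 * (N t \<omega> * (N t \<omega> - 1))"
      using X_Nats[OF t]
    proof eventually_elim
      case (elim \<omega>)
      \<comment> \<open>With i jumps (1, 0) and j jumps (1, a), \<open>step_val\<close> has the form
        e^j F(i + j) for e = exp(iay) and F n = \<Phi>(y \<theta>^n), which is the shape handled by
        \<open>first_order_expansion\<close>.\<close>
      obtain i j where ij: "U \<omega> = real i" "W \<omega> = real j"
        using elim unfolding U_def W_def by (auto elim!: Nats_cases)
      then have L: "L t \<omega> = real j * a" and N: "N t \<omega> = real (i + j)"
        using a_pos unfolding U_def W_def by (auto simp: field_simps)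
      have "iexp (y * L t \<omega>) = iexp (a * y) ^ j"
        unfolding L by (simp add: mult_ac flip: exp_of_nat_mult)
      then show ?case
        using first_order_expansion[of "iexp (a * y)" "\<lambda>n. \<Phi> (y * \<theta> ^ n)" j i] norm_\<Phi>
        unfolding R_def step_val_def X_def ij N by (simp add: mult.commute[of y \<theta>] nat_int_add)
    qed
  qed (use HX R mom in auto)
  also have "\<dots> = 3 * ((u + w) * t)\<^sup>2" using mom by simp
  finally show ?thesis .
qed

definition Y :: "nat \<Rightarrow> nat \<Rightarrow> 'a \<Rightarrow> real" where
  "Y n j \<omega> = dyadic_sum \<theta> (\<lambda>t. N t \<omega>) (\<lambda>t. L t \<omega>) n j"

definition K :: "nat \<Rightarrow> nat \<Rightarrow> 'a \<Rightarrow> real" where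
  "K n j \<omega> = \<theta> ^ nat \<lfloor>N (dyadic n j) \<omega>\<rfloor>"

lemma K_meas [measurable]: "K n j \<in> borel_measurable M"
  unfolding K_def using N_meas[of "dyadic n j"] by simp

lemma Y_meas [measurable]: "Y n j \<in> borel_measurable M"
  unfolding Y_def dyadic_sum_def K_def[symmetric]
  by (intro borel_measurable_sum borel_measurable_times K_meas borel_measurable_diff L_meas) simp_all

text \<open>\<open>Y\<close> and \<open>K\<close> at grid index j are measurable functions of the
  increments up to index j, and the next increment is independent of those.\<close>

lemma indep_past_increment:
  "indep_var borel (\<lambda>\<omega>. (Y n j \<omega>, K n j \<omega>)) borel (\<lambda>\<omega>. X (dyadic n (Suc j)) \<omega> - X (dyadic n j) \<omega>)"
proof -
  define D where "D i \<omega> = (if i = 0 then X (dyadic n 0) \<omega> else X (dyadic n i) \<omega> - X (dyadic n (i - 1)) \<omega>)" for i \<omega>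
  have "indep_vars (\<lambda>_. borel) D {..Suc j}"
    using independent_increments[of "dyadic n" "Suc j"] unfolding D_def X_def[symmetric] by simp
  then have ind: "indep_var (PiM {..j} (\<lambda>_. borel)) (\<lambda>\<omega>. restrict (\<lambda>i. D i \<omega>) {..j})
      (PiM {Suc j} (\<lambda>_. borel)) (\<lambda>\<omega>. restrict (\<lambda>i. D i \<omega>) {Suc j})"
    by (rule indep_var_restrict) auto
  \<comment> \<open>Rebuilds the pair from increments alone. Since \<open>D 0\<close> is the initial
    value, partial sums of first coordinates telescope to \<open>N\<close> at grid points, and the
    increment of \<open>L\<close> over cell i sits at index i + 1.\<close>
  define P where "P x = ((\<Sum>i<j. \<theta> ^ nat \<lfloor>\<Sum>l\<le>i. fst (x l)\<rfloor> * snd (x (Suc i))), \<theta> ^ nat \<lfloor>\<Sum>l\<le>j. fst (x l)\<rfloor>)"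
    for x :: "nat \<Rightarrow> real \<times> real"
  have comp: "(\<lambda>x. x l) \<in> borel_measurable (PiM {..j} (\<lambda>_. borel :: (real \<times> real) measure))" if "l \<le> j" for l
    using that by (intro measurable_component_singleton) auto
  have [measurable]: "(\<lambda>x. fst (x l)) \<in> borel_measurable (PiM {..j} (\<lambda>_. borel :: (real \<times> real) measure))"
    "(\<lambda>x. snd (x l)) \<in> borel_measurable (PiM {..j} (\<lambda>_. borel :: (real \<times> real) measure))" if "l \<le> j" for l
    using measurable_compose[OF comp[OF that] fst_meas] measurable_compose[OF comp[OF that] snd_meas] by auto
  have S: "(\<lambda>x. \<Sum>l\<le>i. fst (x l)) \<in> borel_measurable (PiM {..j} (\<lambda>_. borel :: (real \<times> real) measure))" if "i \<le> j" for i
    using that by (intro borel_measurable_sum) auto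
  have "P \<in> borel_measurable (PiM {..j} (\<lambda>_. borel))"
    unfolding P_def by (intro borel_measurable_Pair borel_measurable_sum borel_measurable_times
        measurable_compose[OF S, of _ "\<lambda>s. \<theta> ^ nat \<lfloor>s\<rfloor>"]) auto
  moreover have "(\<lambda>x. x (Suc j)) \<in> borel_measurable (PiM {Suc j} (\<lambda>_. borel :: (real \<times> real) measure))"
    by (intro measurable_component_singleton) auto
  ultimately have ind': "indep_var borel (P \<circ> (\<lambda>\<omega>. restrict (\<lambda>i. D i \<omega>) {..j}))
      borel ((\<lambda>x. x (Suc j)) \<circ> (\<lambda>\<omega>. restrict (\<lambda>i. D i \<omega>) {Suc j}))"
    by (rule indep_var_compose[OF ind])
  have tele: "(\<Sum>l\<le>i. fst (D l \<omega>)) = N (dyadic n i) \<omega>" for i \<omega>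
    by (induction i) (auto simp: D_def X_def)
  have "P \<circ> (\<lambda>\<omega>. restrict (\<lambda>i. D i \<omega>) {..j}) = (\<lambda>\<omega>. (Y n j \<omega>, K n j \<omega>))"
  proof
    fix \<omega>
    have "(\<Sum>l\<le>i. fst (restrict (\<lambda>i. D i \<omega>) {..j} l)) = N (dyadic n i) \<omega>" if "i \<le> j" for i
      using that by (subst tele[symmetric]) (intro sum.cong, auto)
    moreover have "snd (D (Suc i) \<omega>) = L (dyadic n (Suc i)) \<omega> - L (dyadic n i) \<omega>" for i
      by (simp add: D_def X_def)
    ultimately show "(P \<circ> (\<lambda>\<omega>. restrict (\<lambda>i. D i \<omega>) {..j})) \<omega> = (Y n j \<omega>, K n j \<omega>)"
      unfolding P_def comp_def Y_def K_def dyadic_sum_def by (auto intro!: sum.cong)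
  qed
  moreover have "(\<lambda>x. x (Suc j)) \<circ> (\<lambda>\<omega>. restrict (\<lambda>i. D i \<omega>) {Suc j}) = (\<lambda>\<omega>. X (dyadic n (Suc j)) \<omega> - X (dyadic n j) \<omega>)"
    by (auto simp: D_def fun_eq_iff)
  ultimately show ?thesis using ind' by simp
qed

definition mean_val :: "real \<Rightarrow> nat \<Rightarrow> nat \<Rightarrow> complex" where
  "mean_val z n j = (LINT \<omega>|M. iexp (z * Y n j \<omega>) * \<Phi> (z * K n j \<omega>))"

text \<open>Conditionally on the past, the next factor is \<open>step_val\<close> in the random
  state zK, averaged over a fresh increment. The one-step estimate is uniform in the state and the
  phase of the past has modulus 1, so the same bound survives the outer average.\<close>

lemma mean_val_increment: "norm (mean_val z n (Suc j) - mean_val z n j) \<le> 3 * ((u + w) / 2 ^ n)\<^sup>2"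
proof -
  let ?t = "1 / 2 ^ n :: real"
  define B where "B \<omega> = X (dyadic n (Suc j)) \<omega> - X (dyadic n j) \<omega>" for \<omega>
  define G where "G q = iexp (z * fst (fst q)) * step_val (z * snd (fst q)) (snd q)" for q :: "(real \<times> real) \<times> (real \<times> real)"
  have G_meas: "G \<in> borel_measurable (borel \<Otimes>\<^sub>M borel)"
    unfolding G_def step_val_def by measurable
  have norm_G: "norm (G q) \<le> 1" for q
    unfolding G_def using norm_step_val by (simp add: norm_mult)
  have "mean_val z n (Suc j) = (LINT \<omega>|M. G ((Y n j \<omega>, K n j \<omega>), B \<omega>))"
    unfolding mean_val_def
  proof (rule integral_cong_AE)
    \<comment> \<open>The factorisation of \<theta>^N across a cell needs \<open>N\<close> and its
      increment to be natural numbers, since floors are not additive in general; hence equality only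
      almost everywhere.\<close>
    show "AE \<omega> in M. iexp (z * Y n (Suc j) \<omega>) * \<Phi> (z * K n (Suc j) \<omega>) = G ((Y n j \<omega>, K n j \<omega>), B \<omega>)"
      using AE_stepping_path
    proof eventually_elim
      case (elim \<omega>)
      interpret stepping_path "\<lambda>t. N t \<omega>" "\<lambda>t. L t \<omega>" a by (rule elim)
      have "K n (Suc j) \<omega> = K n j \<omega> * \<theta> ^ nat \<lfloor>fst (B \<omega>)\<rfloor>"
      proof -
        obtain m where m: "N (dyadic n (Suc j)) \<omega> - N (dyadic n j) \<omega> = real m"
          using incr_f[of n j] by (auto elim: Nats_cases)
        have "N (dyadic n (Suc j)) \<omega> = real (nat \<lfloor>N (dyadic n j) \<omega>\<rfloor> + m)"
          using m real_nat_floor_f[of "dyadic n j"] by simp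
        then have "nat \<lfloor>N (dyadic n (Suc j)) \<omega>\<rfloor> = nat \<lfloor>N (dyadic n j) \<omega>\<rfloor> + m"
          by (metis floor_of_nat nat_int)
        then show ?thesis using m by (simp add: K_def B_def X_def power_add)
      qed
      moreover have "Y n (Suc j) \<omega> = Y n j \<omega> + K n j \<omega> * snd (B \<omega>)"
        by (simp add: Y_def K_def dyadic_sum_def B_def X_def)
      ultimately show ?case
        by (simp add: G_def step_val_def ring_distribs exp_add mult.assoc)
    qed
  next
    have "B \<in> borel_measurable M" unfolding B_def by (intro borel_measurable_diff X_meas) auto
    then have "(\<lambda>\<omega>. ((Y n j \<omega>, K n j \<omega>), B \<omega>)) \<in> M \<rightarrow>\<^sub>M (borel \<Otimes>\<^sub>M borel)"
      by (intro measurable_Pair borel_measurable_Pair Y_meas K_meas)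
    then show "(\<lambda>\<omega>. G ((Y n j \<omega>, K n j \<omega>), B \<omega>)) \<in> borel_measurable M"
      using measurable_compose G_meas by blast
  qed measurable
  also have "\<dots> = (LINT \<omega>|M. (LINT \<omega>'|M. G ((Y n j \<omega>, K n j \<omega>), B \<omega>')))"
    unfolding B_def by (rule indep_var_integral[OF indep_past_increment G_meas norm_G])
  also have "\<dots> = (LINT \<omega>|M. iexp (z * Y n j \<omega>) * (LINT \<omega>'|M. step_val (z * K n j \<omega>) (X ?t \<omega>')))"
    using X_diff_integral(1)[OF _ _ step_val_meas, of "dyadic n j" ?t]
    by (simp add: G_def B_def dyadic_Suc)
  finally have eq: "mean_val z n (Suc j) = (LINT \<omega>|M. iexp (z * Y n j \<omega>) * (LINT \<omega>'|M. step_val (z * K n j \<omega>) (X ?t \<omega>')))" .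
  have X_t [measurable]: "X ?t \<in> borel_measurable M" by (rule X_meas) simp
  have [measurable]: "(\<lambda>y. LINT \<omega>'|M. step_val y (X ?t \<omega>')) \<in> borel_measurable borel"
    unfolding step_val_def by measurable
  have i1: "integrable M (\<lambda>\<omega>. iexp (z * Y n j \<omega>) * (LINT \<omega>'|M. step_val (z * K n j \<omega>) (X ?t \<omega>')))"
  proof (rule integrable_const_bound[where B = 1])
    have "norm (LINT \<omega>'|M. step_val y (X ?t \<omega>')) \<le> (LINT \<omega>'|M. 1)" for y
      using norm_step_val measurable_compose[OF X_t step_val_meas]
      by (intro norm_integral_le_integral integrable_const_bound[where B = 1]) auto
    then show "AE \<omega> in M. norm (iexp (z * Y n j \<omega>) * (LINT \<omega>'|M. step_val (z * K n j \<omega>) (X ?t \<omega>'))) \<le> 1"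
      by (simp add: norm_mult prob_space)
  qed measurable
  have i2: "integrable M (\<lambda>\<omega>. iexp (z * Y n j \<omega>) * \<Phi> (z * K n j \<omega>))"
    using norm_\<Phi> by (intro integrable_const_bound[where B = 1]) (auto simp: norm_mult)
  have "norm (mean_val z n (Suc j) - mean_val z n j) =
      norm (LINT \<omega>|M. iexp (z * Y n j \<omega>) * ((LINT \<omega>'|M. step_val (z * K n j \<omega>) (X ?t \<omega>')) - \<Phi> (z * K n j \<omega>)))"
    unfolding eq unfolding mean_val_def using i1 i2 by (simp add: right_diff_distrib)
  also have "\<dots> \<le> (LINT \<omega>|M. 3 * ((u + w) * ?t)\<^sup>2)"
  proof (rule norm_integral_le_integral)
    show "integrable M (\<lambda>\<omega>. iexp (z * Y n j \<omega>) * ((LINT \<omega>'|M. step_val (z * K n j \<omega>) (X ?t \<omega>')) - \<Phi> (z * K n j \<omega>)))"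
      using Bochner_Integration.integrable_diff[OF i1 i2] by (simp add: right_diff_distrib)
  qed (use expectation_step_val[of ?t] in \<open>simp_all add: norm_mult\<close>)
  finally show ?thesis by (simp add: prob_space)
qed

lemma mean_val_0: "mean_val z n 0 = \<Phi> z"
proof -
  have "mean_val z n 0 = (LINT \<omega>|M. \<Phi> z)"
    unfolding mean_val_def
  proof (rule integral_cong_AE)
    show "AE \<omega> in M. iexp (z * Y n 0 \<omega>) * \<Phi> (z * K n 0 \<omega>) = \<Phi> z"
      using start_zero by eventually_elim (simp add: Y_def K_def dyadic_sum_def zero_prod_def)
  qed measurable
  then show ?thesis by (simp add: prob_space)
qed

text \<open>Starting from the exact value \<Phi>(z), the n 2^n steps accumulate an error of at most
  3 (u + w)^2 n 2^-n.\<close>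

lemma mean_val_tendsto: "(\<lambda>n. mean_val z n (n * 2 ^ n)) \<longlonglongrightarrow> \<Phi> z"
proof -
  have bound: "norm (mean_val z n j - \<Phi> z) \<le> real j * (3 * ((u + w) / 2 ^ n)\<^sup>2)" for n j
  proof (induction j)
    case (Suc j)
    then show ?case
      using norm_triangle_ineq[of "mean_val z n (Suc j) - mean_val z n j" "mean_val z n j - \<Phi> z"] mean_val_increment[of z n j]
      by (simp add: ring_distribs)
  qed (simp add: mean_val_0)
  have "(\<lambda>n. 3 * (u + w)\<^sup>2 * (real n * (1 / 2) ^ n)) \<longlonglongrightarrow> 3 * (u + w)\<^sup>2 * 0"
    by (intro tendsto_mult tendsto_const powser_times_n_limit_0) auto
  moreover have eq: "real (n * 2 ^ n) * (3 * ((u + w) / 2 ^ n)\<^sup>2) = 3 * (u + w)\<^sup>2 * (real n * (1 / 2) ^ n)" for n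
    by (simp add: power2_eq_square field_simps)
  ultimately have "(\<lambda>n. real (n * 2 ^ n) * (3 * ((u + w) / 2 ^ n)\<^sup>2)) \<longlonglongrightarrow> 0"
    by (simp only: eq mult_zero_right)
  then have "(\<lambda>n. mean_val z n (n * 2 ^ n) - \<Phi> z) \<longlonglongrightarrow> 0"
    by (rule Lim_null_comparison[rotated]) (intro always_eventually allI bound)
  then show ?thesis by (simp add: LIM_zero_iff)
qed

text \<open>The means have two limits that must agree: \<Phi>(z) by the error estimate, and the
  characteristic function of the limit variable because K tends to 0 and \<Phi> to 1. The support
  bound passes from the sums to their limit since the interval is closed.\<close>

lemma law_of_stepping_limit:
  fixes Z :: "'a \<Rightarrow> real"
  assumes lim: "AE \<omega> in M. (\<lambda>n. dyadic_sum \<theta> (\<lambda>t. N t \<omega>) (\<lambda>t. L t \<omega>) n (n * 2 ^ n)) \<longlonglongrightarrow> Z \<omega>"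
  shows "char (law M Z) z = \<Phi> z" and "measure_support (law M Z) \<subseteq> {0..a / (1 - \<theta>)}"
proof -
  have YZ: "AE \<omega> in M. (\<lambda>n. Y n (n * 2 ^ n) \<omega>) \<longlonglongrightarrow> Z \<omega>"
    using lim by (simp add: Y_def)
  \<comment> \<open>A measurable version of \<open>Z\<close>, obtained as the limit of the
    measurable Riemann sums.\<close>
  define Z' where "Z' \<omega> = lim (\<lambda>n. Y n (n * 2 ^ n) \<omega>)" for \<omega>
  have Z' [measurable]: "Z' \<in> borel_measurable M"
    unfolding Z'_def by (rule borel_measurable_lim_metric) measurable
  have eq: "AE \<omega> in M. Z \<omega> = Z' \<omega>"
    using YZ by eventually_elim (simp add: Z'_def limI)
  note law = law_eq_distr[OF Z' eq]
  have YZ': "AE \<omega> in M. (\<lambda>n. Y n (n * 2 ^ n) \<omega>) \<longlonglongrightarrow> Z' \<omega>"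
    using YZ eq by eventually_elim simp
  have "(\<lambda>n. mean_val z n (n * 2 ^ n)) \<longlonglongrightarrow> (LINT \<omega>|M. iexp (z * Z' \<omega>))"
    unfolding mean_val_def
  proof (rule integral_dominated_convergence[where w = "\<lambda>_. 1"])
    show "AE \<omega> in M. (\<lambda>n. iexp (z * Y n (n * 2 ^ n) \<omega>) * \<Phi> (z * K n (n * 2 ^ n) \<omega>)) \<longlonglongrightarrow> iexp (z * Z' \<omega>)"
      using YZ' AE_power_N_tendsto_0[OF \<theta>]
    proof eventually_elim
      case (elim \<omega>)
      have "(\<lambda>n. \<Phi> (z * K n (n * 2 ^ n) \<omega>)) \<longlonglongrightarrow> 1"
        unfolding K_def dyadic_end by (intro tendsto_\<Phi> tendsto_mult_right_zero elim(2))
      then have "(\<lambda>n. iexp (z * Y n (n * 2 ^ n) \<omega>) * \<Phi> (z * K n (n * 2 ^ n) \<omega>)) \<longlonglongrightarrow> iexp (z * Z' \<omega>) * 1"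
        by (intro tendsto_intros elim(1))
      then show ?case by simp
    qed
  qed (use norm_\<Phi> in \<open>auto simp: norm_mult\<close>)
  with mean_val_tendsto[of z] have "(LINT \<omega>|M. iexp (z * Z' \<omega>)) = \<Phi> z"
    using LIMSEQ_unique by blast
  then show "char (law M Z) z = \<Phi> z"
    unfolding law char_def by (subst integral_distr) auto
  have "AE \<omega> in M. Z' \<omega> \<in> {0..a / (1 - \<theta>)}"
    using YZ' stepping_sum_bounds[OF \<theta>]
  proof eventually_elim
    case (elim \<omega>)
    show ?case
      using elim(2) by (intro Lim_in_closed_set[OF closed_atLeastAtMost _ _ elim(1)]) (auto simp: Y_def)
  qed
  then have "AE x in law M Z. x \<in> {0..a / (1 - \<theta>)}"
    unfolding law by (subst AE_distr_iff) auto
  then have "emeasure (law M Z) (- {0..a / (1 - \<theta>)}) = 0"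
    by (subst (asm) AE_iff_measurable[where N = "- {0..a / (1 - \<theta>)}"]) (auto simp: law)
  then show "measure_support (law M Z) \<subseteq> {0..a / (1 - \<theta>)}"
    by (intro measure_support_subset_closed) auto
qed

end

lemma AE_first_jump:
  "AE \<omega> in M. (\<lambda>n. dyadic_sum 0 (\<lambda>t. N t \<omega>) (\<lambda>t. L t \<omega>) n (n * 2 ^ n))
    \<longlonglongrightarrow> L (first_jump_time (\<lambda>t. N t \<omega>)) \<omega>"
  using AE_stepping_path AE_power_N_tendsto_0[of 0, OF order_refl zero_less_one]
proof eventually_elim
  case (elim \<omega>)
  interpret stepping_path "\<lambda>t. N t \<omega>" "\<lambda>t. L t \<omega>" a by (rule elim)
  have "eventually (\<lambda>n. (0::real) ^ nat \<lfloor>N (real n) \<omega>\<rfloor> < 1) sequentially"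
    using elim(2) by (rule order_tendstoD) simp
  then obtain n where "(0::real) ^ nat \<lfloor>N (real n) \<omega>\<rfloor> < 1" by (auto simp: eventually_sequentially)
  then have "0 < N (real n) \<omega>" by (auto simp: power_0_left split: if_splits)
  then show ?case by (intro tendsto_first_jump[of "real n"]) auto
qed

lemma AE_exp_integral:
  "AE \<omega> in M. (\<lambda>n. dyadic_sum (1 / c) (\<lambda>t. N t \<omega>) (\<lambda>t. L t \<omega>) n (n * 2 ^ n))
    \<longlonglongrightarrow> exp_integral c (\<lambda>t. N t \<omega>) (\<lambda>t. L t \<omega>)"
  using AE_stepping_path
  by eventually_elim (rule stepping_path.tendsto_exp_integral[OF _ c_gt_1])

end

section \<open>The quasi-Levy exponents\<close>

lemma countable_product_integral:
  fixes f :: "'i::countable \<times> 'j::countable \<Rightarrow> 'b::{banach, second_countable_topology}"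
  assumes "integrable (count_space UNIV) f"
  shows "integral\<^sup>L (count_space UNIV) f = (LINT i|count_space UNIV. LINT j|count_space UNIV. f (i, j))"
  using infsetsum_Times[of "UNIV :: 'i set" "UNIV :: 'j set" f] assms
  by (simp add: infsetsum_def Infinite_Set_Sum.abs_summable_on_def)

lemma countable_product_integrable:
  fixes f :: "'i::countable \<Rightarrow> real" and g :: "'j::countable \<Rightarrow> real"
  assumes "integrable (count_space UNIV) f" "integrable (count_space UNIV) g"
  shows "integrable (count_space UNIV) (\<lambda>(i, j). f i * g j)"
  using abs_summable_on_product[where f = f and g = g and A = "UNIV :: 'i set" and B = "UNIV :: 'j set"] assms
  by (simp add: Infinite_Set_Sum.abs_summable_on_def)

lemma integrable_geometric:
  fixes s :: real
  assumes "0 \<le> s" "s < 1"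
  shows "integrable (count_space UNIV) (\<lambda>n::nat. s ^ n)"
  using assms by (simp add: integrable_count_space_nat_iff)

section \<open>The logarithm of a two-point characteristic function, with s = p/r\<close>

locale log_weights =
  fixes s :: real
  assumes s_pos: "0 < s" and s_less_1: "s < 1"
begin

text \<open>Taylor coefficients of ln(1 + s x): \<open>weight m\<close> belongs to x^(m + 1). With x
  = exp(-iy) they become signed masses at the points -(m + 1).\<close>

definition weight :: "nat \<Rightarrow> real" where
  "weight m = (-1) ^ m * s ^ Suc m / real (Suc m)"

lemma abs_weight: "\<bar>weight m\<bar> * real (Suc m) = s ^ Suc m"
  using s_pos by (simp add: weight_def abs_mult power_abs del: of_nat_Suc)

lemma integrable_power_Suc: "integrable (count_space UNIV) (\<lambda>m. s ^ Suc m)"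
  using integrable_geometric[of s] s_pos s_less_1 by simp

lemma integrable_weight_mult: "integrable (count_space UNIV) (\<lambda>m. weight m * real (Suc m))"
  by (rule Bochner_Integration.integrable_bound[OF integrable_power_Suc])
    (use abs_weight s_pos in \<open>auto simp: abs_mult simp del: of_nat_Suc\<close>)

text \<open>Growth linear in m + 1, as produced by |exp(iyx) - 1| <= |y| |x| at x = -(m + 1),
  cancels the denominator of the weight and leaves a geometric series.\<close>

lemma weight_bound:
  fixes g :: "nat \<Rightarrow> complex"
  assumes g: "\<And>m. norm (g m) \<le> C * real (Suc m)"
  shows "integrable (count_space UNIV) (\<lambda>m. weight m *\<^sub>R g m)"
    and "norm (CLINT m|count_space UNIV. weight m *\<^sub>R g m) \<le> C * (\<Sum>m. s ^ Suc m)"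
proof -
  have C: "0 \<le> C" using order_trans[OF norm_ge_zero g[of 0]] by simp
  have le: "norm (weight m *\<^sub>R g m) \<le> C * s ^ Suc m" for m
  proof -
    have "norm (weight m *\<^sub>R g m) \<le> \<bar>weight m\<bar> * (C * real (Suc m))"
      using g[of m] by (simp add: mult_left_mono del: of_nat_Suc)
    also have "\<dots> = C * s ^ Suc m" by (simp only: mult.left_commute[of _ C] abs_weight)
    finally show ?thesis .
  qed
  have i: "integrable (count_space UNIV) (\<lambda>m. C * s ^ Suc m)"
    by (intro integrable_mult_right integrable_power_Suc)
  show int: "integrable (count_space UNIV) (\<lambda>m. weight m *\<^sub>R g m)"
    by (rule Bochner_Integration.integrable_bound[OF i])
      (use le C s_pos in \<open>auto simp del: power_Suc intro!: AE_I2 order_trans[OF _ abs_ge_self]\<close>)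
  have "norm (CLINT m|count_space UNIV. weight m *\<^sub>R g m) \<le> (LINT m|count_space UNIV. C * s ^ Suc m)"
    by (rule norm_integral_le_integral[OF int i le])
  also have "\<dots> = C * (\<Sum>m. s ^ Suc m)"
    using integrable_power_Suc by (simp add: integral_count_space_nat del: power_Suc)
  finally show "norm (CLINT m|count_space UNIV. weight m *\<^sub>R g m) \<le> C * (\<Sum>m. s ^ Suc m)" .
qed

definition log_char :: "real \<Rightarrow> complex" where
  "log_char y = (CLINT m|count_space UNIV. weight m *\<^sub>R (iexp (y * - real (Suc m)) - 1))"

text \<open>The series is a Lipschitz constant of \<open>log_char\<close>, and the summand 1 is that
  of the drift iy.\<close>

definition lip :: real where
  "lip = (\<Sum>m. s ^ Suc m) + 1"

lemma iexp_diff_bound: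
  "norm (iexp (y * - real (Suc m)) - iexp (y' * - real (Suc m))) \<le> \<bar>y - y'\<bar> * real (Suc m)"
proof -
  have "\<bar>y * - real (Suc m) - y' * - real (Suc m)\<bar> = \<bar>y - y'\<bar> * real (Suc m)"
    unfolding left_diff_distrib[symmetric] abs_mult by (simp del: of_nat_Suc)
  then show ?thesis
    using norm_iexp_diff_le[of "y * - real (Suc m)" "y' * - real (Suc m)"] by simp
qed

lemma integrable_log_char:
  "integrable (count_space UNIV) (\<lambda>m. weight m *\<^sub>R (iexp (y * - real (Suc m)) - 1))"
  using iexp_diff_bound[of y _ 0] by (intro weight_bound(1)[where C = "\<bar>y\<bar>"]) simp

lemma log_char_lipschitz: "norm (log_char y - log_char y') \<le> \<bar>y - y'\<bar> * (\<Sum>m. s ^ Suc m)"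
proof -
  have "log_char y - log_char y' =
      (CLINT m|count_space UNIV. weight m *\<^sub>R (iexp (y * - real (Suc m)) - iexp (y' * - real (Suc m))))"
    unfolding log_char_def using integrable_log_char[of y] integrable_log_char[of y']
    by (simp del: of_nat_Suc flip: Bochner_Integration.integral_diff scaleR_diff_right)
  also have "norm \<dots> \<le> \<bar>y - y'\<bar> * (\<Sum>m. s ^ Suc m)"
    by (rule weight_bound(2)) (rule iexp_diff_bound)
  finally show ?thesis .
qed

lemma log_char_0: "log_char 0 = 0"
  by (simp add: log_char_def)

lemma weight_sums: "(\<lambda>m. weight m *\<^sub>R iexp (y * - real (Suc m))) sums ln (1 + of_real s * iexp (- y))"
proof -
  let ?z = "of_real s * iexp (- y)"
  have "(\<lambda>n. (-1) ^ Suc n / of_nat n * ?z ^ n) sums ln (1 + ?z)"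
    using s_pos s_less_1 by (intro Ln_series) (simp add: norm_mult)
  then have "(\<lambda>n. (-1) ^ Suc (Suc n) / of_nat (Suc n) * ?z ^ Suc n) sums ln (1 + ?z)"
    using sums_Suc_iff[of "\<lambda>n. (-1) ^ Suc n / of_nat n * ?z ^ n" "ln (1 + ?z)"] by simp
  moreover have "(-1) ^ Suc (Suc m) / of_nat (Suc m) * ?z ^ Suc m = weight m *\<^sub>R iexp (y * - real (Suc m))" for m
  proof -
    have "iexp (- y) ^ Suc m = iexp (y * - real (Suc m))"
      by (subst exp_of_nat_mult[symmetric]) (simp add: algebra_simps)
    then have "?z ^ Suc m = of_real (s ^ Suc m) * iexp (y * - real (Suc m))"
      by (simp only: power_mult_distrib of_real_power)
    then show ?thesis
      by (simp add: weight_def scaleR_conv_of_real del: power_Suc of_nat_Suc) simp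
  qed
  ultimately show ?thesis by (simp only:)
qed

text \<open>Subtracting the logarithmic series at 0 from that at y gives ln(1 + s exp(-iy)) - ln(1 +
  s), and the drift factor exp(iy) turns 1 + s exp(-iy) into exp(iy) + s. For s = p/r, division by 1
  + s yields p + r exp(iy).\<close>

lemma exp_log_char:
  "exp (log_char y + \<i> * of_real y) * of_real (1 + s) = of_real s + iexp y"
proof -
  have "log_char y = ln (1 + of_real s * iexp (- y)) - ln (1 + of_real s)"
  proof -
    have "(\<lambda>m. weight m *\<^sub>R (iexp (y * - real (Suc m)) - 1)) sums log_char y"
      unfolding log_char_def by (rule sums_integral_count_space_nat[OF integrable_log_char])
    moreover have "(\<lambda>m. weight m *\<^sub>R (iexp (y * - real (Suc m)) - 1)) sums
        (ln (1 + of_real s * iexp (- y)) - ln (1 + of_real s))"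
      using sums_diff[OF weight_sums[of y] weight_sums[of 0]] by (simp add: scaleR_diff_right)
    ultimately show ?thesis by (rule sums_unique2)
  qed
  \<comment> \<open>Here s < 1, that is p < r, keeps 1 + s exp(-iy) away from 0, so the exponential
    undoes the principal logarithm.\<close>
  moreover have "norm (of_real s * iexp (- y)) < 1" using s_pos s_less_1 by (simp add: norm_mult)
  then have "1 + of_real s * iexp (- y) \<noteq> 0"
    by (metis add_eq_0_iff norm_minus_cancel norm_one less_irrefl)
  moreover have "1 + complex_of_real s \<noteq> 0"
    using s_pos by (metis add_pos_pos of_real_1 of_real_add of_real_eq_0_iff less_irrefl zero_less_one)
  ultimately have "exp (log_char y + \<i> * of_real y) * of_real (1 + s) = (1 + of_real s * iexp (- y)) * iexp y"
    by (simp add: exp_add exp_diff)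
  also have "\<dots> = of_real s + iexp y"
    by (simp add: ring_distribs mult.assoc flip: exp_add)
  finally show ?thesis .
qed

definition log_atom :: "real \<Rightarrow> complex" where
  "log_atom y = log_char y + \<i> * of_real y"

lemma log_atom_lipschitz: "norm (log_atom y - log_atom y') \<le> lip * \<bar>y - y'\<bar>"
proof -
  have "norm (log_atom y - log_atom y') = norm ((log_char y - log_char y') + \<i> * of_real (y - y'))"
    by (simp add: log_atom_def algebra_simps)
  also have "\<dots> \<le> \<bar>y - y'\<bar> * (\<Sum>m. s ^ Suc m) + \<bar>y - y'\<bar>"
    by (rule order_trans[OF norm_triangle_ineq], rule add_mono[OF log_char_lipschitz])
      (simp only: norm_mult norm_ii norm_of_real mult_1_left order_refl)
  finally show ?thesis by (simp add: lip_def algebra_simps)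
qed

lemma log_atom_0: "log_atom 0 = 0"
  by (simp add: log_atom_def log_char_0)

lemma lip_nonneg: "0 \<le> lip"
  using log_atom_lipschitz[of 1 0] order_trans[OF norm_ge_zero] by fastforce

lemma continuous_log_atom: "continuous_on UNIV log_atom"
  by (rule lipschitz_on_continuous_on[of lip])
    (auto intro!: lipschitz_onI simp: dist_norm log_atom_lipschitz lip_nonneg)

section \<open>The infinite product of rescaled two-point factors and its exponent\<close>

context
  fixes \<theta> a :: real
  assumes \<theta>: "0 \<le> \<theta>" "\<theta> < 1" and a_pos: "0 \<le> a"
begin

definition log_prod :: "real \<Rightarrow> complex" where
  "log_prod z = (\<Sum>n. log_atom (a * \<theta> ^ n * z))"

lemma summable_geom: "summable (\<lambda>n. a * \<theta> ^ n)"
  using \<theta> by (intro summable_mult summable_geometric) auto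

text \<open>Treating differences of terms serves two purposes at once: z' = 0 gives convergence of
  the series, and general z' gives the Lipschitz bound behind the continuity of
  \<open>log_prod\<close>.\<close>

lemma log_atom_summable: "summable (\<lambda>n. log_atom (a * \<theta> ^ n * z) - log_atom (a * \<theta> ^ n * z'))"
  and log_prod_lipschitz: "norm (\<Sum>n. log_atom (a * \<theta> ^ n * z) - log_atom (a * \<theta> ^ n * z')) \<le> lip * (\<Sum>n. a * \<theta> ^ n) * \<bar>z - z'\<bar>"
proof -
  have le: "norm (log_atom (a * \<theta> ^ n * z) - log_atom (a * \<theta> ^ n * z')) \<le> lip * \<bar>z - z'\<bar> * (a * \<theta> ^ n)" for n
  proof -
    have "\<bar>a * \<theta> ^ n * z - a * \<theta> ^ n * z'\<bar> = \<bar>z - z'\<bar> * (a * \<theta> ^ n)"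
      unfolding right_diff_distrib[symmetric] abs_mult[of "a * \<theta> ^ n"] using \<theta> a_pos by simp
    then show ?thesis
      using log_atom_lipschitz[of "a * \<theta> ^ n * z" "a * \<theta> ^ n * z'"] by (simp add: mult.assoc)
  qed
  have S: "summable (\<lambda>n. lip * \<bar>z - z'\<bar> * (a * \<theta> ^ n))" by (intro summable_mult summable_geom)
  show "summable (\<lambda>n. log_atom (a * \<theta> ^ n * z) - log_atom (a * \<theta> ^ n * z'))"
    by (rule summable_comparison_test'[OF S]) (rule le)
  have "norm (\<Sum>n. log_atom (a * \<theta> ^ n * z) - log_atom (a * \<theta> ^ n * z')) \<le> (\<Sum>n. lip * \<bar>z - z'\<bar> * (a * \<theta> ^ n))"
    by (rule norm_suminf_le[OF le S])
  also have "\<dots> = lip * \<bar>z - z'\<bar> * (\<Sum>n. a * \<theta> ^ n)"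
    by (rule suminf_mult[OF summable_geom])
  finally show "norm (\<Sum>n. log_atom (a * \<theta> ^ n * z) - log_atom (a * \<theta> ^ n * z')) \<le> lip * (\<Sum>n. a * \<theta> ^ n) * \<bar>z - z'\<bar>"
    by (simp add: mult_ac)
qed

lemma summable_log_atom: "summable (\<lambda>n. log_atom (a * \<theta> ^ n * z))"
  using log_atom_summable[of z 0] by (simp add: log_atom_0)

lemma continuous_log_prod: "continuous_on UNIV log_prod"
proof (rule lipschitz_on_continuous_on, rule lipschitz_onI)
  show "dist (log_prod z) (log_prod z') \<le> lip * (\<Sum>n. a * \<theta> ^ n) * dist z z'" for z z'
    using log_prod_lipschitz[of z z'] suminf_diff[OF summable_log_atom summable_log_atom, of z z']
    by (simp add: log_prod_def dist_norm)
  show "0 \<le> lip * (\<Sum>n. a * \<theta> ^ n)"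
    using \<theta> a_pos by (intro mult_nonneg_nonneg lip_nonneg suminf_nonneg summable_geom) auto
qed

lemma log_prod_0: "log_prod 0 = 0"
  by (simp add: log_prod_def log_atom_0)

lemma log_prod_step: "log_prod z = log_atom (a * z) + log_prod (\<theta> * z)"
  using suminf_split_head[OF summable_log_atom, of z] by (simp add: log_prod_def mult_ac)

text \<open>Each factor contributes its own atoms and the drift a \<theta>^n. The double family is
  absolutely integrable because its first moments factor into a geometric sequence in n and the
  weighted moments in m, so Fubini merges the sums while the drifts are added separately.\<close>

lemma log_prod_integral:
  "log_prod z = (CLINT (n, m)|count_space UNIV. weight m *\<^sub>R (iexp (z * - (a * \<theta> ^ n * real (Suc m))) - 1))
     + \<i> * of_real (\<Sum>n. a * \<theta> ^ n) * of_real z"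
  and log_prod_integrable: "integrable (count_space UNIV) (\<lambda>(n, m). weight m * - (a * \<theta> ^ n * real (Suc m)))"
proof -
  let ?f = "\<lambda>(n, m). weight m *\<^sub>R (iexp (z * - (a * \<theta> ^ n * real (Suc m))) - 1)"
  have "integrable (count_space UNIV) (\<lambda>(n, m). (- a * \<theta> ^ n) * (weight m * real (Suc m)))"
    using integrable_geometric[OF \<theta>] integrable_weight_mult by (intro countable_product_integrable) auto
  also have "(\<lambda>(n, m). (- a * \<theta> ^ n) * (weight m * real (Suc m))) = (\<lambda>(n, m). weight m * - (a * \<theta> ^ n * real (Suc m)))"
    by (auto simp: fun_eq_iff)
  finally show i: "integrable (count_space UNIV) (\<lambda>(n, m). weight m * - (a * \<theta> ^ n * real (Suc m)))" .
  have int: "integrable (count_space UNIV) ?f"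
  proof (rule Bochner_Integration.integrable_bound)
    show "integrable (count_space UNIV) (\<lambda>q. z * (\<lambda>(n, m). weight m * - (a * \<theta> ^ n * real (Suc m))) q)"
      using i by (rule integrable_mult_right)
    have "norm (weight m *\<^sub>R (iexp (z * - (a * \<theta> ^ n * real (Suc m))) - 1)) \<le> norm (z * (weight m * - (a * \<theta> ^ n * real (Suc m))))" for n m
    proof -
      have "norm (weight m *\<^sub>R (iexp (z * - (a * \<theta> ^ n * real (Suc m))) - 1)) \<le> \<bar>weight m\<bar> * \<bar>z * - (a * \<theta> ^ n * real (Suc m))\<bar>"
        using norm_iexp_diff_le[of "z * - (a * \<theta> ^ n * real (Suc m))" 0] unfolding norm_scaleR
        by (intro mult_left_mono) auto
      then show ?thesis by (simp add: abs_mult mult_ac del: of_nat_Suc)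
    qed
    then show "AE q in count_space UNIV. norm (?f q) \<le> norm (z * (\<lambda>(n, m). weight m * - (a * \<theta> ^ n * real (Suc m))) q)"
      by (auto simp del: of_nat_Suc)
  qed simp
  have inner: "(CLINT m|count_space UNIV. ?f (n, m)) = log_char (a * \<theta> ^ n * z)" for n
    unfolding log_char_def by (simp add: mult_ac del: of_nat_Suc)
  have lc: "norm (log_char (a * \<theta> ^ n * z)) \<le> \<bar>z\<bar> * (\<Sum>m. s ^ Suc m) * (a * \<theta> ^ n)" for n
    using log_char_lipschitz[of "a * \<theta> ^ n * z" 0] \<theta> a_pos by (simp add: log_char_0 abs_mult mult_ac)
  have Sn: "summable (\<lambda>n. norm (log_char (a * \<theta> ^ n * z)))"
    by (rule summable_comparison_test'[OF summable_mult[OF summable_geom]]) (use lc in simp)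
  have S: "summable (\<lambda>n. log_char (a * \<theta> ^ n * z))" using Sn by (rule summable_norm_cancel)
  have "integral\<^sup>L (count_space UNIV) ?f = (CLINT n|count_space UNIV. log_char (a * \<theta> ^ n * z))"
    by (subst countable_product_integral[OF int]) (simp only: inner)
  also have "\<dots> = (\<Sum>n. log_char (a * \<theta> ^ n * z))"
    using Sn by (intro integral_count_space_nat) (simp add: integrable_count_space_nat_iff)
  finally have "log_prod z = integral\<^sup>L (count_space UNIV) ?f + (\<Sum>n. \<i> * of_real (a * \<theta> ^ n * z))"
    unfolding log_prod_def log_atom_def
    using suminf_add[OF S, of "\<lambda>n. \<i> * of_real (a * \<theta> ^ n * z)"] summable_geom
    by (simp add: summable_of_real summable_mult summable_mult2 del: of_real_mult)
  also have "(\<Sum>n. \<i> * of_real (a * \<theta> ^ n * z)) = \<i> * of_real ((\<Sum>n. a * \<theta> ^ n) * z)"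
    using summable_geom by (subst suminf_mult) (auto simp: summable_of_real summable_mult2 suminf_of_real suminf_mult2 simp del: of_real_mult)
  finally show "log_prod z = integral\<^sup>L (count_space UNIV) ?f + \<i> * of_real (\<Sum>n. a * \<theta> ^ n) * of_real z"
    by (simp add: mult.assoc)
qed

end

end

theorem corollary4p2:
  fixes M :: "'a measure" and N L :: "real \<Rightarrow> 'a \<Rightarrow> real"
    and c p q r u v w :: real and k :: int
  assumes "c > 1" and "q = 0" and "0 < p" and "p < r" and "p + r = 1"
    and "NL_process M N L c k u v w"
    and "p = u / (u + v + w)" and "q = v / (u + v + w)" and "r = w / (u + v + w)"
  shows "bounded (measure_support (rho M N L)) \<and> measure_support (rho M N L) \<subseteq> {0..} \<and>
    bounded (measure_support (mu M c N L)) \<and> measure_support (mu M c N L) \<subseteq> {0..} \<and>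
    (\<exists>\<nu>p \<nu>m. is_quasi_levy_measure (rho M N L) \<nu>p \<nu>m \<and>
      (\<forall>z. signed_integrable \<nu>p \<nu>m (\<lambda>x. iexp (z * x) - 1) \<and>
        char (rho M N L) z =
          exp (signed_integral \<nu>p \<nu>m (\<lambda>x. iexp (z * x) - 1) +
            \<i> * of_real (c powi (-k)) * of_real z)) \<and>
      signed_concentrated_on \<nu>p \<nu>m {..<0}) \<and>
    (\<exists>\<nu>p \<nu>m. is_quasi_levy_measure (mu M c N L) \<nu>p \<nu>m \<and>
      (\<forall>z. signed_integrable \<nu>p \<nu>m (\<lambda>x. iexp (z * x) - 1) \<and>
        char (mu M c N L) z =
          exp (signed_integral \<nu>p \<nu>m (\<lambda>x. iexp (z * x) - 1) +
            \<i> * of_real (\<Sum>n. c powi (-k - int n)) * of_real z)) \<and>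
      signed_concentrated_on \<nu>p \<nu>m {..<0})"
proof -
  interpret NL: NL_process M N L c k u v w by fact
  have sum: "0 < u + v + w" using NL.masses_nonneg NL.masses_pos by auto
  have v: "v = 0" and u: "0 < u" and "u < w"
    using assms sum by (auto simp: divide_simps split: if_splits)
  interpret NL_process_q0 M N L c k u v w
    by unfold_locales (use v u \<open>u < w\<close> in auto)
  \<comment> \<open>The masses enter through the ratio u/w = p/r, which is below 1 by
    assumption.\<close>
  interpret log_weights "u / w"
    by unfold_locales (use u \<open>u < w\<close> in auto)
  have a: "0 \<le> a" "c powi (- k) = a" using a_pos by (auto simp: a_def)
  have atom_eq: "of_real (u + w) * exp (log_atom (a * z)) = of_real u + of_real w * iexp (a * z)" for z
  proof -
    have "of_real (u + w) * exp (log_atom (a * z)) = of_real w * (exp (log_atom (a * z)) * of_real (1 + u / w))"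
      using w_pos by (simp add: field_simps)
    also have "\<dots> = of_real w * (of_real (u / w) + iexp (a * z))"
      unfolding log_atom_def exp_log_char ..
    also have "\<dots> = of_real u + of_real w * iexp (a * z)"
      using w_pos by (simp add: ring_distribs)
    finally show ?thesis .
  qed
  have bounded: "bounded S \<and> S \<subseteq> {0..}" if "S \<subseteq> {0..B}" for S and B :: real
    using that bounded_subset[OF bounded_closed_interval] by auto

  have rho: "char (rho M N L) z = exp (log_atom (a * z))" "measure_support (rho M N L) \<subseteq> {0..a / (1 - 0)}" for z
  proof -
    \<comment> \<open>For \<theta> = 0 the factor \<Phi>(\<theta>z) is \<Phi>(0) = 1, so the
      functional equation reduces to \<open>atom_eq\<close> and one factor of the product is already
      the whole characteristic function.\<close>
    note law = law_of_stepping_limit[of 0 "\<lambda>z. exp (log_atom (a * z))", OF _ _ _ _ _ AE_first_jump]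
    have cont: "continuous_on UNIV (\<lambda>z. exp (log_atom (a * z)))"
      by (intro continuous_intros continuous_on_compose2[OF continuous_log_atom]) auto
    show "char (rho M N L) z = exp (log_atom (a * z))" "measure_support (rho M N L) \<subseteq> {0..a / (1 - 0)}"
      unfolding rho_def by (intro law; use cont atom_eq in \<open>simp add: log_atom_0\<close>)+
  qed

  define \<theta> where "\<theta> = 1 / c"
  have \<theta>: "0 < \<theta>" "\<theta> < 1" using \<open>c > 1\<close> by (auto simp: \<theta>_def)
  note prod = log_prod_step[OF less_imp_le[OF \<theta>(1)] \<theta>(2) a(1)]
    log_prod_0[OF less_imp_le[OF \<theta>(1)] \<theta>(2) a(1)]
    continuous_log_prod[OF less_imp_le[OF \<theta>(1)] \<theta>(2) a(1)]
    log_prod_integral[OF less_imp_le[OF \<theta>(1)] \<theta>(2) a(1)]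
    log_prod_integrable[OF less_imp_le[OF \<theta>(1)] \<theta>(2) a(1)]
  have mu: "char (mu M c N L) z = exp (log_prod \<theta> a z)" "measure_support (mu M c N L) \<subseteq> {0..a / (1 - \<theta>)}" for z
  proof -
    note law = law_of_stepping_limit[of \<theta> "\<lambda>z. exp (log_prod \<theta> a z)", OF _ _ _ _ _ AE_exp_integral[folded \<theta>_def]]
    have cont: "continuous_on UNIV (\<lambda>z. exp (log_prod \<theta> a z))"
      by (intro continuous_intros prod(3))
    have eq: "of_real (u + w) * exp (log_prod \<theta> a z) =
        (of_real u + of_real w * iexp (a * z)) * exp (log_prod \<theta> a (\<theta> * z))" for z
      by (simp only: prod(1)[of z] exp_add atom_eq flip: mult.assoc)
    show "char (mu M c N L) z = exp (log_prod \<theta> a z)" "measure_support (mu M c N L) \<subseteq> {0..a / (1 - \<theta>)}"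
      unfolding mu_def using \<theta> cont eq prod(2) by (intro law; simp)+
  qed

  have qrho: "\<exists>\<nu>p \<nu>m. is_quasi_levy_measure (rho M N L) \<nu>p \<nu>m \<and>
      (\<forall>z. signed_integrable \<nu>p \<nu>m (\<lambda>x. iexp (z * x) - 1) \<and>
        char (rho M N L) z =
          exp (signed_integral \<nu>p \<nu>m (\<lambda>x. iexp (z * x) - 1) +
            \<i> * of_real (c powi (-k)) * of_real z)) \<and>
      signed_concentrated_on \<nu>p \<nu>m {..<0}"
  proof (rule quasi_levy_of_discrete_exponent[where b = weight and x = "\<lambda>m. - (a * real (Suc m))"])
    show "- (a * real (Suc m)) < 0" for m using a_pos by simp
    show "integrable (count_space UNIV) (\<lambda>m. weight m * - (a * real (Suc m)))"
      using integrable_mult_right[OF integrable_weight_mult, of "- a"] by (simp add: mult_ac del: of_nat_Suc)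
    show "char (rho M N L) z = exp ((CLINT m|count_space UNIV. weight m *\<^sub>R (iexp (z * - (a * real (Suc m))) - 1))
        + \<i> * of_real (c powi (- k)) * of_real z)" for z
      unfolding rho(1) log_atom_def log_char_def a(2) by (simp add: mult_ac del: of_nat_Suc)
  qed

  have powi: "c powi (- k - int n) = a * \<theta> ^ n" for n
    using \<open>c > 1\<close> by (simp add: power_int_diff a_def \<theta>_def power_one_over)
  have qmu: "\<exists>\<nu>p \<nu>m. is_quasi_levy_measure (mu M c N L) \<nu>p \<nu>m \<and>
      (\<forall>z. signed_integrable \<nu>p \<nu>m (\<lambda>x. iexp (z * x) - 1) \<and>
        char (mu M c N L) z =
          exp (signed_integral \<nu>p \<nu>m (\<lambda>x. iexp (z * x) - 1) +
            \<i> * of_real (\<Sum>n. c powi (-k - int n)) * of_real z)) \<and>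
      signed_concentrated_on \<nu>p \<nu>m {..<0}"
  \<comment> \<open>Atoms are indexed by pairs (scale n, order m). Different pairs may name the same
    point, which the discrete representation permits because \<open>x\<close> need not be
    injective.\<close>
  proof (rule quasi_levy_of_discrete_exponent[where b = "\<lambda>(n, m). weight m"
        and x = "\<lambda>(n, m). - (a * \<theta> ^ n * real (Suc m))"])
    show "(case i of (n, m) \<Rightarrow> - (a * \<theta> ^ n * real (Suc m))) < 0" for i
      using a_pos \<theta> by (simp add: split_beta)
    show "integrable (count_space UNIV)
        (\<lambda>i. (case i of (n, m) \<Rightarrow> weight m) * (case i of (n, m) \<Rightarrow> - (a * \<theta> ^ n * real (Suc m))))"
      using prod(5) by (simp only: case_prod_unfold)
    show "char (mu M c N L) z = exp ((CLINT i|count_space UNIV. (case i of (n, m) \<Rightarrow> weight m) *\<^sub>R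
        (iexp (z * (case i of (n, m) \<Rightarrow> - (a * \<theta> ^ n * real (Suc m)))) - 1))
        + \<i> * of_real (\<Sum>n. c powi (-k - int n)) * of_real z)" for z
      unfolding mu(1) prod(4) powi by (simp only: case_prod_unfold)
  qed
  show ?thesis
    using bounded[OF rho(2)] bounded[OF mu(2)] qrho qmu by blast
qed

end
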